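(* Let $S$ be a standard graded polynomial ring over a field $K$ in finitely many variables. If $M \ne 0$ is any $d$-dimensional, finitely generated graded $S$-module, then its Macaulay constants satisfy \[ b_0(M) \ge b_1(M) \ge \cdots \ge b_d(M) > b_{d+1}(M) = e^+(M). \]
   Context: **Setting.** $K$ is any field, $S=K[X]$ is the polynomial ring with finite variable set $X$ and standard grading (all variables have degree one). Graded means $\mathbb Z$-graded. Dimension is Krull dimension. For a finitely generated graded $S$-module $M\ne 0$, $e^+(M)$ is the maximum degree of a minimal generator of $M$. **Cone decompositions.** Given $M\neq 0$, choose a minimal epimorphism $\varphi: F\to M$: $F$ is graded free with a homogeneous basis mapped bijectively and degree-preservingly onto a homogeneous minimal generating set of $M$. Put $Q=\ker\varphi$, fix a monomial order $<$ on $F$, and let $N_M\subseteq F$ be the $K$-span of the monomials of $F$ not in $\operatorname{in}_<(Q)$; then $N_M\cong M$ as graded $K$-vector spaces. A cone is a subspace $hK[U]\subseteq F$ with $0\ne h\in F$ homogeneous and $U\subseteq X$; its dimension is $|U|$. A cone decomposition of $M$ is a finite direct sum decomposition $N_M=\bigoplus_{i=1}^s h_iK[U_i]$ into cones. It is $q$-standard if (a) $\deg h_i\ge q$ whenever $U_i\ne\emptyset$, and (b) for every $i$ with $U_i\neq\emptyset$ and every integer $c$ with $q\le c\le\deg h_i$ there is some $j$ with $\deg h_j=c$ and $|U_j|\ge|U_i|$. It is $q$-exact if it is $q$-standard and $\deg h_i\ne\deg h_j$ for all $i\ne j$ with $U_i\ne\emptyset\ne U_j$. Every $M \ne 0$ admits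 an $e^+(M)$-exact cone decomposition. **Macaulay constants.** Let $d=\dim M$ and let $P$ be an $e^+(M)$-exact cone decomposition of $M$. It has the form \[ P=\bigoplus_{k=1}^{s}h_{k,0}K\ \oplus\ \bigoplus_{j=1}^{d}\ \bigoplus_{k=b_{j+1}}^{b_j-1}h_{k,j}K[U_{k,j}], \] where $|U_{k,j}|=j$, $\deg h_{k,j}=k$ if $j\ge1$, and, if $d\ge 1$, $b_1\ge\cdots\ge b_{d+1}=e^+(M)$. Let $b_0$ be $1$ plus the maximum degree of all cone generators in $P$; if $d=0$, put $b_1=e^+(M)$. The integers $b_i(M):=b_i$, $0\le i\le d+1$, are the Macaulay constants of $M$; they are independent of the choices. *)

theory Defs
  imports
    "HOL-Library.Poly_Mapping"
    "HOL-Library.Extended_Nat"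
    "HOL-Library.FuncSet"
    "HOL-Algebra.QuotRing"
    "HOL-Algebra.Module"
begin

subsection \<open>Polynomial rings\<close>

text \<open>A polynomial is a finitely supported function on monomials, a monomial a finitely
  supported exponent function. The variable set \<open>X\<close> is an arbitrary subset of a type, so
  that it may also be empty.\<close>

type_synonym ('x, 'k) mpoly = "('x \<Rightarrow>\<^sub>0 nat) \<Rightarrow>\<^sub>0 'k"

definition monoms :: "'x set \<Rightarrow> ('x \<Rightarrow>\<^sub>0 nat) set" where
  "monoms X = {u. Poly_Mapping.keys u \<subseteq> X}"

definition monom_deg :: "('x \<Rightarrow>\<^sub>0 nat) \<Rightarrow> nat" where
  "monom_deg u = (\<Sum>x\<in>Poly_Mapping.keys u. Poly_Mapping.lookup u x)"

definition mpoly_ring :: "'x set \<Rightarrow> ('x, 'k::field) mpoly ring" where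
  "mpoly_ring X = \<lparr>carrier = {p. Poly_Mapping.keys p \<subseteq> monoms X},
     monoid.mult = (*), one = 1, zero = 0, add = (+)\<rparr>"

definition mpoly_comp :: "'x set \<Rightarrow> nat \<Rightarrow> ('x, 'k::field) mpoly set" where
  "mpoly_comp X n = {p \<in> carrier (mpoly_ring X). \<forall>u\<in>Poly_Mapping.keys p. monom_deg u = n}"


subsection \<open>Krull dimension\<close>

definition krull_dim :: "('a, 'z) ring_scheme \<Rightarrow> enat" where
  "krull_dim R = Sup {enat n | n. \<exists>p :: nat \<Rightarrow> 'a set.
     (\<forall>i\<le>n. primeideal (p i) R) \<and> (\<forall>i<n. p i \<subset> p (Suc i))}"

definition annihilator :: "('a, 'z) ring_scheme \<Rightarrow> ('a, 'm, 'w) module_scheme \<Rightarrow> 'a set" where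
  "annihilator R M = {a \<in> carrier R. \<forall>x\<in>carrier M. a \<odot>\<^bsub>M\<^esub> x = \<zero>\<^bsub>M\<^esub>}"

definition module_dim :: "('a, 'z) ring_scheme \<Rightarrow> ('a, 'm, 'w) module_scheme \<Rightarrow> enat" where
  "module_dim R M = krull_dim (R Quot (annihilator R M))"


subsection \<open>Graded modules and minimal generators\<close>

locale graded_module = module "mpoly_ring X" M
  for X :: "'x set" and M :: "(('x, 'k::field) mpoly, 'm, 'w) module_scheme" (structure) +
  fixes gr :: "int \<Rightarrow> 'm set"
  assumes finite_vars: "finite X"
    and comp_subgroup: "\<And>n. subgroup (gr n) (add_monoid M)"
    and comp_direct_sum: "\<And>x. x \<in> carrier M \<Longrightarrow>
      \<exists>!c. (\<forall>n. c n \<in> gr n) \<and> finite {n. c n \<noteq> \<zero>} \<and> x = (\<Oplus>n\<in>{n. c n \<noteq> \<zero>}. c n)"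
    and comp_smult: "\<And>i n p x. p \<in> mpoly_comp X i \<Longrightarrow> x \<in> gr n \<Longrightarrow> p \<odot> x \<in> gr (int i + n)"

definition gen_submodule ::
  "('a, 'z) ring_scheme \<Rightarrow> ('a, 'm, 'w) module_scheme \<Rightarrow> 'm set \<Rightarrow> 'm set" where
  "gen_submodule R M A = \<Inter>{N. submodule N R M \<and> A \<subseteq> N}"

definition finitely_generated :: "('a, 'z) ring_scheme \<Rightarrow> ('a, 'm, 'w) module_scheme \<Rightarrow> bool" where
  "finitely_generated R M \<longleftrightarrow>
     (\<exists>A. finite A \<and> A \<subseteq> carrier M \<and> gen_submodule R M A = carrier M)"

text \<open>The degree of a nonzero homogeneous element.\<close>

definition hdeg :: "(int \<Rightarrow> 'v set) \<Rightarrow> 'v \<Rightarrow> int" where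
  "hdeg gr x = (THE n. x \<in> gr n)"

definition min_hom_gens ::
  "('a, 'z) ring_scheme \<Rightarrow> ('a, 'm, 'w) module_scheme \<Rightarrow> (int \<Rightarrow> 'm set) \<Rightarrow> 'm set \<Rightarrow> bool" where
  "min_hom_gens R M gr G \<longleftrightarrow>
     finite G \<and> G \<subseteq> (\<Union>n. gr n) \<and> gen_submodule R M G = carrier M \<and>
     (\<forall>H. H \<subset> G \<longrightarrow> gen_submodule R M H \<noteq> carrier M)"

definition e_plus ::
  "('a, 'z) ring_scheme \<Rightarrow> ('a, 'm, 'w) module_scheme \<Rightarrow> (int \<Rightarrow> 'm set) \<Rightarrow> int" where
  "e_plus R M gr = Max {hdeg gr g | g. \<exists>G. min_hom_gens R M gr G \<and> g \<in> G}"


subsection \<open>Minimal presentations\<close>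

text \<open>Given a homogeneous minimal generating set \<open>G\<close> of \<open>M\<close>, the basis of the graded free
  module \<open>F\<close> is indexed by \<open>G\<close> itself; the basis element of index \<open>g\<close> has the degree of \<open>g\<close> and
  is mapped to \<open>g\<close>. Every minimal epimorphism is of this form up to renaming the basis. Elements
  of \<open>F\<close> are coordinate functions. The fields \<open>mult\<close> and \<open>one\<close> are required by the record type
  of modules but have no meaning for a module.\<close>

definition free_module :: "'x set \<Rightarrow> 'm set \<Rightarrow> (('x, 'k::field) mpoly, 'm \<Rightarrow> ('x, 'k) mpoly) module"
  where
  "free_module X G = \<lparr>carrier = {f. (\<forall>g\<in>G. f g \<in> carrier (mpoly_ring X)) \<and> (\<forall>g. g \<notin> G \<longrightarrow> f g = 0)},
     monoid.mult = undefined, one = undefined, zero = (\<lambda>_. 0), add = (\<lambda>f f' g. f g + f' g),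
     smult = (\<lambda>p f g. p * f g)\<rparr>"

definition free_comp ::
  "'x set \<Rightarrow> 'm set \<Rightarrow> (int \<Rightarrow> 'm set) \<Rightarrow> int \<Rightarrow> ('m \<Rightarrow> ('x, 'k::field) mpoly) set" where
  "free_comp X G gr n = {f \<in> carrier (free_module X G).
     \<forall>g\<in>G. \<forall>u\<in>Poly_Mapping.keys (f g). int (monom_deg u) + hdeg gr g = n}"

definition pres_ker ::
  "'x set \<Rightarrow> (('x, 'k::field) mpoly, 'm, 'w) module_scheme \<Rightarrow> 'm set \<Rightarrow> ('m \<Rightarrow> ('x, 'k) mpoly) set"
  where
  "pres_ker X M G = {f \<in> carrier (free_module X G). (\<Oplus>\<^bsub>M\<^esub>g\<in>G. f g \<odot>\<^bsub>M\<^esub> g) = \<zero>\<^bsub>M\<^esub>}"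


subsection \<open>Monomial orders and initial modules\<close>

text \<open>The monomial \<open>u \<cdot> e\<^sub>g\<close> of \<open>F\<close> is represented by the pair \<open>(u, g)\<close>. A monomial order is
  given by its reflexive relation; strict compatibility follows from cancellation.\<close>

definition monomial_order :: "'x set \<Rightarrow> 'm set \<Rightarrow> ((('x \<Rightarrow>\<^sub>0 nat) \<times> 'm) rel) \<Rightarrow> bool" where
  "monomial_order X G ord \<longleftrightarrow>
     linear_order_on (monoms X \<times> G) ord \<and>
     (\<forall>u g v g' w. ((u, g), (v, g')) \<in> ord \<longrightarrow> w \<in> monoms X \<longrightarrow> ((w + u, g), (w + v, g')) \<in> ord) \<and>
     (\<forall>u\<in>monoms X. \<forall>g\<in>G. \<forall>w\<in>monoms X. ((u, g), (w + u, g)) \<in> ord)"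

definition mon_vec :: "('x \<Rightarrow>\<^sub>0 nat) \<times> 'm \<Rightarrow> 'm \<Rightarrow> ('x, 'k::field) mpoly" where
  "mon_vec m = (\<lambda>g. if g = snd m then Poly_Mapping.single (fst m) 1 else 0)"

definition mon_supp :: "('m \<Rightarrow> ('x, 'k::field) mpoly) \<Rightarrow> (('x \<Rightarrow>\<^sub>0 nat) \<times> 'm) set" where
  "mon_supp f = {(u, g). u \<in> Poly_Mapping.keys (f g)}"

definition lead_mon ::
  "(('x \<Rightarrow>\<^sub>0 nat) \<times> 'm) rel \<Rightarrow> ('m \<Rightarrow> ('x, 'k::field) mpoly) \<Rightarrow> ('x \<Rightarrow>\<^sub>0 nat) \<times> 'm" where
  "lead_mon ord f = (THE m. m \<in> mon_supp f \<and> (\<forall>m'\<in>mon_supp f. (m', m) \<in> ord))"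

definition initial_module ::
  "'x set \<Rightarrow> 'm set \<Rightarrow> (('x \<Rightarrow>\<^sub>0 nat) \<times> 'm) rel \<Rightarrow> ('m \<Rightarrow> ('x, 'k::field) mpoly) set
     \<Rightarrow> ('m \<Rightarrow> ('x, 'k) mpoly) set" where
  "initial_module X G ord Q = gen_submodule (mpoly_ring X) (free_module X G)
     {mon_vec (lead_mon ord f) | f. f \<in> Q \<and> f \<noteq> (\<lambda>_. 0)}"

text \<open>The \<open>K\<close>-span of the monomials outside the initial module consists of the elements of \<open>F\<close>
  supported on such monomials.\<close>

definition standard_space ::
  "'x set \<Rightarrow> 'm set \<Rightarrow> (('x \<Rightarrow>\<^sub>0 nat) \<times> 'm) rel \<Rightarrow> ('m \<Rightarrow> ('x, 'k::field) mpoly) set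
     \<Rightarrow> ('m \<Rightarrow> ('x, 'k) mpoly) set" where
  "standard_space X G ord Q = {f \<in> carrier (free_module X G).
     \<forall>m\<in>mon_supp f. (mon_vec m :: 'm \<Rightarrow> ('x, 'k) mpoly) \<notin> initial_module X G ord Q}"


subsection \<open>Cone decompositions\<close>

definition cone :: "('m \<Rightarrow> ('x, 'k::field) mpoly) \<Rightarrow> 'x set \<Rightarrow> ('m \<Rightarrow> ('x, 'k) mpoly) set" where
  "cone h U = {(\<lambda>g. p * h g) | p. p \<in> carrier (mpoly_ring U)}"

text \<open>A cone decomposition is a list of pairs \<open>(h\<^sub>i, U\<^sub>i)\<close>.\<close>

type_synonym ('m, 'x, 'k) cones = "(('m \<Rightarrow> ('x, 'k) mpoly) \<times> 'x set) list"

definition cone_decomposition ::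
  "'x set \<Rightarrow> (('x, 'k::field) mpoly, 'm, 'w) module_scheme \<Rightarrow> (int \<Rightarrow> 'm set) \<Rightarrow> 'm set
     \<Rightarrow> (('x \<Rightarrow>\<^sub>0 nat) \<times> 'm) rel \<Rightarrow> ('m, 'x, 'k) cones \<Rightarrow> bool" where
  "cone_decomposition X M gr G ord P \<longleftrightarrow>
     (\<forall>(h, U)\<in>set P. h \<noteq> (\<lambda>_. 0) \<and> (\<exists>n. h \<in> free_comp X G gr n) \<and> U \<subseteq> X \<and>
        cone h U \<subseteq> standard_space X G ord (pres_ker X M G)) \<and>
     (\<forall>f\<in>standard_space X G ord (pres_ker X M G).
        \<exists>!c. c \<in> (\<Pi>\<^sub>E i\<in>{..<length P}. cone (fst (P ! i)) (snd (P ! i))) \<and>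
             f = (\<lambda>g. \<Sum>i<length P. c i g))"

text \<open>In the next three definitions \<open>dg\<close> is the degree function on generators of cones.\<close>

definition q_standard ::
  "(('m \<Rightarrow> ('x, 'k) mpoly) \<Rightarrow> int) \<Rightarrow> int \<Rightarrow> ('m, 'x, 'k::zero) cones \<Rightarrow> bool" where
  "q_standard dg q P \<longleftrightarrow>
     (\<forall>(h, U)\<in>set P. U \<noteq> {} \<longrightarrow> q \<le> dg h) \<and>
     (\<forall>(h, U)\<in>set P. U \<noteq> {} \<longrightarrow>
        (\<forall>c. q \<le> c \<and> c \<le> dg h \<longrightarrow> (\<exists>(h', U')\<in>set P. dg h' = c \<and> card U \<le> card U')))"

definition q_exact ::
  "(('m \<Rightarrow> ('x, 'k) mpoly) \<Rightarrow> int) \<Rightarrow> int \<Rightarrow> ('m, 'x, 'k::zero) cones \<Rightarrow> bool" where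
  "q_exact dg q P \<longleftrightarrow> q_standard dg q P \<and>
     (\<forall>i<length P. \<forall>j<length P. i \<noteq> j \<longrightarrow> snd (P ! i) \<noteq> {} \<longrightarrow> snd (P ! j) \<noteq> {} \<longrightarrow>
        dg (fst (P ! i)) \<noteq> dg (fst (P ! j)))"

text \<open>\<open>cone_form dg e d P b\<close> says that \<open>P\<close> has no cones of dimension greater than \<open>d\<close>, and that
  for \<open>1 \<le> j \<le> d\<close> its cones of dimension \<open>j\<close> can be indexed by their degrees
  \<open>k = b\<^sub>j\<^sub>+\<^sub>1, \<dots>, b\<^sub>j - 1\<close>. The range may be empty, so \<open>b\<^sub>j\<^sub>+\<^sub>1 \<le> b\<^sub>j\<close> is
  needed for \<open>P\<close> to determine \<open>b\<^sub>1, \<dots>, b\<^sub>d\<close>. For \<open>d = 0\<close> the second line reads \<open>b\<^sub>1 = e\<close>.\<close>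

definition cone_form ::
  "(('m \<Rightarrow> ('x, 'k) mpoly) \<Rightarrow> int) \<Rightarrow> int \<Rightarrow> nat \<Rightarrow> ('m, 'x, 'k::zero) cones \<Rightarrow> (nat \<Rightarrow> int) \<Rightarrow> bool"
  where
  "cone_form dg e d P b \<longleftrightarrow>
     (\<forall>(h, U)\<in>set P. card U \<le> d) \<and>
     b (Suc d) = e \<and>
     (\<forall>j\<in>{1..d}. b (Suc j) \<le> b j \<and>
        bij_betw (\<lambda>i. dg (fst (P ! i))) {i. i < length P \<and> card (snd (P ! i)) = j}
          {b (Suc j)..b j - 1}) \<and>
     b 0 = 1 + Max ((\<lambda>(h, U). dg h) ` set P)"

text \<open>\<open>b 0, \<dots>, b (d + 1)\<close> are the Macaulay constants of the \<open>d\<close>-dimensional module \<open>M\<close>,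
  computed from some choice of minimal generators, monomial order and exact cone decomposition.\<close>

definition macaulay_constants ::
  "'x set \<Rightarrow> (('x, 'k::field) mpoly, 'm, 'w) module_scheme \<Rightarrow> (int \<Rightarrow> 'm set) \<Rightarrow> nat
     \<Rightarrow> (nat \<Rightarrow> int) \<Rightarrow> bool" where
  "macaulay_constants X M gr d b \<longleftrightarrow> (\<exists>G ord P.
     min_hom_gens (mpoly_ring X) M gr G \<and>
     monomial_order X G ord \<and>
     cone_decomposition X M gr G ord P \<and>
     q_exact (hdeg (free_comp X G gr)) (e_plus (mpoly_ring X) M gr) P \<and>
     cone_form (hdeg (free_comp X G gr)) (e_plus (mpoly_ring X) M gr) d P b)"

end

theory Submission
  imports Defs "HOL-Library.Function_Algebras"
begin

text \<open>Only the strict inequality \<open>b\<^sub>d > b\<^sub>d\<^sub>+\<^sub>1\<close> is not immediate; it says that there is a cone of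
  dimension \<open>d\<close> (\<open>d > 0\<close>), or that some cone generator has degree at least \<open>e\<^sup>+(M)\<close> (\<open>d = 0\<close>).

  Let \<open>d > 0\<close> and let \<open>P\<^sub>0 \<subset> \<dots> \<subset> P\<^sub>d\<close> be primes containing the annihilator of \<open>M\<close>. Elements
  \<open>y\<^sub>i \<in> P\<^sub>i\<^sub>+\<^sub>1 - P\<^sub>i\<close> are algebraically independent modulo \<open>P\<^sub>0\<close>, and \<open>P\<^sub>0\<close> contains the annihilator of a
  single generator \<open>g\<close>. Hence the \<open>(n + 1)\<^sup>d\<close> products \<open>y\<^sup>\<alpha> e\<^sub>g\<close> with exponents at most \<open>n\<close> are linearly
  independent modulo the kernel of the presentation. Their degrees grow linearly in \<open>n\<close>, so if all cones
  had dimension less than \<open>d\<close>, they would lie, modulo the kernel, in a space of dimension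
  \<open>O(n\<^sup>d\<^sup>-\<^sup>1)\<close>.

  For \<open>d = 0\<close>, the basis monomials \<open>e\<^sub>g\<close> of the free module are standard by minimality of the generating
  set, and a cone decomposition can only produce \<open>e\<^sub>g\<close> from a cone generator of the degree of \<open>g\<close>.\<close>

subsection \<open>Polynomials\<close>

lemma monom_deg_eq:
  assumes "finite V" "Poly_Mapping.keys u \<subseteq> V"
  shows "monom_deg u = (\<Sum>x\<in>V. Poly_Mapping.lookup u x)"
  unfolding monom_deg_def
  by (rule sum.mono_neutral_left) (use assms in \<open>auto simp: in_keys_iff\<close>)

lemma keys_add_nat: "Poly_Mapping.keys (u + v) = Poly_Mapping.keys u \<union> Poly_Mapping.keys v"
  for u v :: "'x \<Rightarrow>\<^sub>0 nat"
  by (auto simp: in_keys_iff lookup_add)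

lemma monom_deg_add [simp]: "monom_deg (u + v) = monom_deg u + monom_deg v"
  using monom_deg_eq[of "Poly_Mapping.keys u \<union> Poly_Mapping.keys v"]
  by (simp add: keys_add_nat lookup_add sum.distrib)

lemma monom_deg_0 [simp]: "monom_deg 0 = 0"
  by (simp add: monom_deg_def)

lemma monom_deg_eq_0 [simp]: "monom_deg u = 0 \<longleftrightarrow> u = 0"
  by (auto simp: monom_deg_def in_keys_iff intro: poly_mapping_eqI)

lemma zero_in_monoms [simp]: "0 \<in> monoms X"
  by (simp add: monoms_def)

lemma monoms_add [simp]: "u + v \<in> monoms X \<longleftrightarrow> u \<in> monoms X \<and> v \<in> monoms X"
  by (auto simp: monoms_def keys_add_nat)

text \<open>An exponent vector of degree at most k is a function from \<open>U\<close> to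
  \<open>{..k}\<close>. The bound is crude, but only its exponent \<open>card U\<close> matters for
  the growth argument.\<close>

lemma monoms_le_count:
  assumes "finite U"
  shows "finite {u \<in> monoms U. monom_deg u \<le> k}"
    and "card {u \<in> monoms U. monom_deg u \<le> k} \<le> Suc k ^ card U"
proof -
  let ?A = "{u \<in> monoms U. monom_deg u \<le> k}"
  let ?B = "PiE U (\<lambda>_. {..k})"
  let ?f = "\<lambda>u. restrict (Poly_Mapping.lookup u) U"
  have sub: "?f ` ?A \<subseteq> ?B"
  proof safe
    fix u x assume u: "u \<in> monoms U" "monom_deg u \<le> k" and "x \<in> U"
    have "Poly_Mapping.lookup u x \<le> (\<Sum>x\<in>U. Poly_Mapping.lookup u x)"
      using assms \<open>x \<in> U\<close> by (intro member_le_sum) auto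
    then show "?f u x \<le> k"
      using u monom_deg_eq[OF assms, of u] \<open>x \<in> U\<close> by (simp add: monoms_def)
  qed auto
  have inj: "inj_on ?f ?A"
  proof (rule inj_onI)
    fix u v assume uv: "u \<in> ?A" "v \<in> ?A" "?f u = ?f v"
    show "u = v"
    proof (rule poly_mapping_eqI)
      fix x show "Poly_Mapping.lookup u x = Poly_Mapping.lookup v x"
      proof (cases "x \<in> U")
        case True then show ?thesis using uv(3) by (metis restrict_apply')
      next
        case False
        then have "x \<notin> Poly_Mapping.keys u" "x \<notin> Poly_Mapping.keys v"
          using uv by (auto simp: monoms_def)
        then show ?thesis by (simp add: in_keys_iff)
      qed
    qed
  qed
  have fin: "finite ?B" using assms by (simp add: finite_PiE)
  show "finite ?A" using inj sub fin by (meson finite_imageD finite_subset)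
  have "card ?A \<le> card ?B" by (rule card_inj_on_le[OF inj sub fin])
  also have "\<dots> = Suc k ^ card U" using assms by (simp add: card_PiE)
  finally show "card ?A \<le> Suc k ^ card U" .
qed

text \<open>Carrier membership as a predicate: \<open>mpoly_ring X\<close> borrows its operations
  from the type of all polynomials, so this side condition is all that remains of the ring
  structure.\<close>

definition poly_in :: "'x set \<Rightarrow> ('x, 'k::field) mpoly \<Rightarrow> bool" where
  "poly_in X p \<longleftrightarrow> Poly_Mapping.keys p \<subseteq> monoms X"

lemma mpoly_ring_simps [simp]:
  "carrier (mpoly_ring X) = {p. poly_in X p}"
  "p \<otimes>\<^bsub>mpoly_ring X\<^esub> q = p * q" "p \<oplus>\<^bsub>mpoly_ring X\<^esub> q = p + q"
  "\<one>\<^bsub>mpoly_ring X\<^esub> = 1" "\<zero>\<^bsub>mpoly_ring X\<^esub> = 0"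
  by (simp_all add: mpoly_ring_def poly_in_def)

lemma poly_in_0 [simp]: "poly_in X 0" and poly_in_1 [simp]: "poly_in X 1"
  by (auto simp: poly_in_def)

lemma poly_in_add [intro]: "poly_in X p \<Longrightarrow> poly_in X q \<Longrightarrow> poly_in X (p + q)"
  using keys_add[of p q] by (auto simp: poly_in_def)

lemma poly_in_uminus [simp]: "poly_in X (- p) \<longleftrightarrow> poly_in X p"
  by (auto simp: poly_in_def in_keys_iff)

lemma poly_in_mult [intro]: "poly_in X p \<Longrightarrow> poly_in X q \<Longrightarrow> poly_in X (p * q)"
  using keys_mult[of p q] by (force simp: poly_in_def)

lemma poly_in_single [simp]: "poly_in X (Poly_Mapping.single u c) \<longleftrightarrow> c = 0 \<or> u \<in> monoms X"
  by (simp add: poly_in_def)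

lemma poly_in_sum: "(\<And>i. i \<in> I \<Longrightarrow> poly_in X (f i)) \<Longrightarrow> poly_in X (sum f I)"
  by (induction I rule: infinite_finite_induct) auto

lemma poly_in_prod: "(\<And>i. i \<in> I \<Longrightarrow> poly_in X (f i)) \<Longrightarrow> poly_in X (prod f I)"
  by (induction I rule: infinite_finite_induct) auto

lemma poly_in_power: "poly_in X p \<Longrightarrow> poly_in X (p ^ n)"
  by (induction n) auto

lemma poly_mapping_sum_single: "p = (\<Sum>u\<in>Poly_Mapping.keys p. Poly_Mapping.single u (Poly_Mapping.lookup p u))"
  by (rule poly_mapping_eqI) (auto simp: lookup_sum lookup_single when_def in_keys_iff)

lemma lookup_single_mult:
  fixes w :: "'x \<Rightarrow>\<^sub>0 nat" and p :: "('x, 'k::field) mpoly"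
  shows "Poly_Mapping.lookup (Poly_Mapping.single w c * p) (w + u) = c * Poly_Mapping.lookup p u"
proof -
  have "Poly_Mapping.single w c * p =
      Poly_Mapping.single w c * (\<Sum>v\<in>Poly_Mapping.keys p. Poly_Mapping.single v (Poly_Mapping.lookup p v))"
    using poly_mapping_sum_single[of p] by metis
  also have "\<dots> = (\<Sum>v\<in>Poly_Mapping.keys p. Poly_Mapping.single (w + v) (c * Poly_Mapping.lookup p v))"
    by (simp add: sum_distrib_left mult_single)
  finally have eq: "Poly_Mapping.single w c * p = \<dots>" .
  show ?thesis
    unfolding eq by (auto simp: lookup_sum lookup_single when_def in_keys_iff)
qed

lemma keys_single_mult:
  fixes w :: "'x \<Rightarrow>\<^sub>0 nat" and p :: "('x, 'k::field) mpoly"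
  assumes "c \<noteq> 0"
  shows "Poly_Mapping.keys (Poly_Mapping.single w c * p) = (+) w ` Poly_Mapping.keys p"
proof
  show "Poly_Mapping.keys (Poly_Mapping.single w c * p) \<subseteq> (+) w ` Poly_Mapping.keys p"
    using keys_mult[of "Poly_Mapping.single w c" p] by (auto simp: keys_single split: if_splits)
  show "(+) w ` Poly_Mapping.keys p \<subseteq> Poly_Mapping.keys (Poly_Mapping.single w c * p)"
    using assms by (auto simp: in_keys_iff lookup_single_mult)
qed

subsection \<open>Chains of prime ideals and algebraic independence\<close>

text \<open>Splitting each \<open>v i\<close> into a part in \<open>span T\<close> and a part in
  \<open>Q\<close>, the first parts are too many to be independent; a relation among them, applied
  to the \<open>v i\<close>, leaves a combination of the parts in \<open>Q\<close>. The vectors form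
  an indexed family, so repetitions count as dependence.\<close>

lemma (in vector_space) dependent_modulo_subspace:
  assumes "subspace Q" "finite T" "finite I" "card T < card I"
    and v: "\<And>i. i \<in> I \<Longrightarrow> v i \<in> span (T \<union> Q)"
  shows "\<exists>c. (\<exists>i\<in>I. c i \<noteq> 0) \<and> (\<Sum>i\<in>I. c i *s v i) \<in> Q"
proof -
  have "\<exists>t. t \<in> span T \<and> v i - t \<in> Q" if "i \<in> I" for i
  proof -
    obtain x y where "v i = x + y" "x \<in> span T" "y \<in> Q"
      using v[OF \<open>i \<in> I\<close>] iffD2[OF span_eq_iff \<open>subspace Q\<close>] unfolding span_Un by auto
    then show ?thesis by (intro exI[of _ x]) simp
  qed
  then obtain t where t: "\<And>i. i \<in> I \<Longrightarrow> t i \<in> span T" "\<And>i. i \<in> I \<Longrightarrow> v i - t i \<in> Q"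
    by metis
  have "\<exists>c. (\<exists>i\<in>I. c i \<noteq> 0) \<and> (\<Sum>i\<in>I. c i *s t i) = 0"
  proof (cases "inj_on t I")
    case True
    have "dependent (t ` I)"
      using independent_span_bound[OF \<open>finite T\<close>, of "t ` I"] t card_image[OF True] assms by auto
    then obtain u where "\<exists>x\<in>t ` I. u x \<noteq> 0" "(\<Sum>x\<in>t ` I. u x *s x) = 0"
      using dependent_finite[of "t ` I"] \<open>finite I\<close> by auto
    then show ?thesis
      by (intro exI[of _ "u \<circ> t"]) (auto simp: sum.reindex[OF True])
  next
    case False
    then obtain i j where ij: "i \<in> I" "j \<in> I" "i \<noteq> j" "t i = t j" by (auto simp: inj_on_def)
    \<comment> \<open>A repeated vector gives the relation with coefficients 1 and -1, written so
      that each sum collapses to one term.\<close>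
    let ?c = "\<lambda>k. (if k = i then 1 else 0) - (if k = j then 1 else 0) :: 'a"
    have "(\<Sum>k\<in>I. ?c k *s t k) =
        (\<Sum>k\<in>I. if k = i then t k else 0) - (\<Sum>k\<in>I. if k = j then t k else 0)"
      unfolding sum_subtractf[symmetric] by (rule sum.cong) (auto simp: scale_left_diff_distrib)
    also have "\<dots> = 0" using ij \<open>finite I\<close> by simp
    finally show ?thesis using ij by (intro exI[of _ ?c]) auto
  qed
  then obtain c where c: "\<exists>i\<in>I. c i \<noteq> 0" "(\<Sum>i\<in>I. c i *s t i) = 0" by blast
  have "(\<Sum>i\<in>I. c i *s v i) = (\<Sum>i\<in>I. c i *s (v i - t i))"
    using c(2) by (simp add: scale_right_diff_distrib sum_subtractf)
  also have "\<dots> \<in> Q"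
    using t \<open>subspace Q\<close> by (intro subspace_sum subspace_scale) auto
  finally show ?thesis using c by blast
qed

lemma primeideal_mpoly:
  fixes p :: "('x, 'k::field) mpoly set"
  assumes "primeideal p (mpoly_ring X)"
  shows primeideal_poly_in: "a \<in> p \<Longrightarrow> poly_in X a"
    and primeideal_0: "0 \<in> p"
    and primeideal_add: "a \<in> p \<Longrightarrow> b \<in> p \<Longrightarrow> a + b \<in> p"
    and primeideal_mult: "a \<in> p \<Longrightarrow> poly_in X b \<Longrightarrow> b * a \<in> p"
    and primeideal_diff: "a \<in> p \<Longrightarrow> b \<in> p \<Longrightarrow> a - b \<in> p"
    and primeideal_prime: "poly_in X a \<Longrightarrow> poly_in X b \<Longrightarrow> a * b \<in> p \<Longrightarrow> a \<in> p \<or> b \<in> p"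
    and primeideal_1: "1 \<notin> p"
proof -
  interpret primeideal p "mpoly_ring X" by fact
  show "a \<in> p \<Longrightarrow> poly_in X a" for a using Icarr by auto
  show "0 \<in> p" using additive_subgroup.zero_closed[OF is_additive_subgroup] by simp
  show add: "a \<in> p \<Longrightarrow> b \<in> p \<Longrightarrow> a + b \<in> p" for a b
    using additive_subgroup.a_closed[OF is_additive_subgroup] by simp
  show mult: "a \<in> p \<Longrightarrow> poly_in X b \<Longrightarrow> b * a \<in> p" for a b using I_l_closed by simp
  show "a \<in> p \<Longrightarrow> b \<in> p \<Longrightarrow> a - b \<in> p" for a b
    using add[of a "- b"] mult[of b "- 1"] by simp
  show "poly_in X a \<Longrightarrow> poly_in X b \<Longrightarrow> a * b \<in> p \<Longrightarrow> a \<in> p \<or> b \<in> p" for a b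
    using I_prime by simp
  show "1 \<notin> p"
    using I_notcarr one_imp_carrier by auto
qed

lemma primeideal_power:
  assumes "primeideal p (mpoly_ring X)" "poly_in X a" "a ^ n \<in> p"
  shows "a \<in> p"
  using assms(3)
proof (induction n)
  case 0 then show ?case using primeideal_1[OF assms(1)] by simp
next
  case (Suc n)
  then show ?case
    using primeideal_prime[OF assms(1,2) poly_in_power[OF assms(2)], of n] by auto
qed

lemma primeideal_prod:
  assumes "primeideal p (mpoly_ring X)" "\<And>i. i \<in> I \<Longrightarrow> poly_in X (f i)" "prod f I \<in> p"
  shows "\<exists>i\<in>I. f i \<in> p"
  using assms(2,3)
proof (induction I rule: infinite_finite_induct)
  case (insert i I)
  then have "f i \<in> p \<or> prod f I \<in> p"
    by (intro primeideal_prime[OF assms(1)]) (auto intro!: poly_in_prod)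
  then show ?case using insert by auto
qed (use primeideal_1[OF assms(1)] in auto)

text \<open>If \<open>y\<^sub>i \<in> P\<^sub>i\<^sub>+\<^sub>1 - P\<^sub>i\<close>, factor out of a relation modulo \<open>P\<^sub>k\<close> the highest power of \<open>y\<^sub>k\<close>
  (allowed as \<open>P\<^sub>k\<close> is prime and \<open>y\<^sub>k \<notin> P\<^sub>k\<close>), then pass to \<open>P\<^sub>k\<^sub>+\<^sub>1\<close>, where \<open>y\<^sub>k\<close> vanishes: what
  remains is a relation between the later \<open>y\<^sub>i\<close>.\<close>

lemma primeideal_chain_independent:
  fixes P :: "nat \<Rightarrow> ('x, 'k::field) mpoly set" and y :: "nat \<Rightarrow> ('x, 'k) mpoly"
  assumes P: "\<And>i. i \<le> d \<Longrightarrow> primeideal (P i) (mpoly_ring X)"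
    and y: "\<And>i. i < d \<Longrightarrow> y i \<in> P (Suc i) - P i"
    and mono: "\<And>i. i < d \<Longrightarrow> P i \<subseteq> P (Suc i)"
    and "k \<le> d" "finite A" "A \<noteq> {}"
    and "inj_on (\<lambda>\<alpha>. restrict \<alpha> {k..<d}) A" "\<And>\<alpha>. \<alpha> \<in> A \<Longrightarrow> c \<alpha> \<noteq> 0"
  shows "(\<Sum>\<alpha>\<in>A. Poly_Mapping.single 0 (c \<alpha>) * (\<Prod>i\<in>{k..<d}. y i ^ \<alpha> i)) \<notin> P k"
  using assms(4-8)
proof (induction k arbitrary: A rule: inc_induct)
  case base
  then obtain \<alpha> where \<alpha>: "\<alpha> \<in> A" by auto
  \<comment> \<open>Over the empty index range all restrictions coincide, so injectivity leaves a
    single exponent vector and the relation is a nonzero constant.\<close>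
  have A: "A = {\<alpha>}"
  proof -
    have "\<beta> = \<alpha>" if "\<beta> \<in> A" for \<beta>
      using inj_onD[OF base(3) _ that \<alpha>] by simp
    with \<alpha> show ?thesis by blast
  qed
  show ?case
  proof
    assume "(\<Sum>\<alpha>\<in>A. Poly_Mapping.single 0 (c \<alpha>) * (\<Prod>i\<in>{d..<d}. y i ^ \<alpha> i)) \<in> P d"
    then have "Poly_Mapping.single 0 (inverse (c \<alpha>)) * Poly_Mapping.single 0 (c \<alpha>) \<in> P d"
      using primeideal_mult[OF P[of d]] by (simp add: A)
    then show False
      using primeideal_1[OF P[of d]] base(4)[OF \<alpha>] by (simp add: mult_single)
  qed
next
  case (step k)
  have yX: "poly_in X (y i)" if "i < d" for i
    using y[OF that] primeideal_poly_in[OF P[of "Suc i"]] that by auto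
  have kd: "k < d" by fact
  \<comment> \<open>The power of \<open>y k\<close> that can be factored out is the least exponent;
    \<open>B\<close> below collects the terms attaining it.\<close>
  define m where "m = Min ((\<lambda>\<alpha>. \<alpha> k) ` A)"
  have m_le: "m \<le> \<alpha> k" if "\<alpha> \<in> A" for \<alpha>
    unfolding m_def using that step.prems by (intro Min_le) auto
  have "m \<in> (\<lambda>\<alpha>. \<alpha> k) ` A" unfolding m_def using step.prems by (intro Min_in) auto
  then obtain \<alpha>\<^sub>0 where \<alpha>\<^sub>0: "\<alpha>\<^sub>0 \<in> A" "\<alpha>\<^sub>0 k = m" by auto
  define B where "B = {\<alpha> \<in> A. \<alpha> k = m}"
  define r where "r \<alpha> = Poly_Mapping.single 0 (c \<alpha>) * (\<Prod>i\<in>{Suc k..<d}. y i ^ \<alpha> i)" for \<alpha>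
  have rX: "poly_in X (r \<alpha>)" for \<alpha>
    unfolding r_def by (intro poly_in_mult poly_in_prod poly_in_power yX) auto
  \<comment> \<open>On \<open>A - B\<close> the exponent of \<open>y k\<close> exceeds
    \<open>m\<close>, so the truncated subtraction is exact and one factor \<open>y k\<close>
    remains in front of \<open>s\<close>.\<close>
  define s where "s = (\<Sum>\<alpha>\<in>A - B. y k ^ (\<alpha> k - m - 1) * r \<alpha>)"
  have sX: "poly_in X s"
    unfolding s_def using kd by (intro poly_in_sum poly_in_mult poly_in_power yX rX) auto
  have BA: "B \<subseteq> A" by (auto simp: B_def)
  have eq: "(\<Sum>\<alpha>\<in>A. Poly_Mapping.single 0 (c \<alpha>) * (\<Prod>i\<in>{k..<d}. y i ^ \<alpha> i)) =
      y k ^ m * ((\<Sum>\<alpha>\<in>B. r \<alpha>) + y k * s)"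
  proof -
    have "(\<Sum>\<alpha>\<in>A. Poly_Mapping.single 0 (c \<alpha>) * (\<Prod>i\<in>{k..<d}. y i ^ \<alpha> i)) =
        (\<Sum>\<alpha>\<in>A. y k ^ \<alpha> k * r \<alpha>)"
      unfolding r_def using kd
      by (intro sum.cong refl) (simp add: prod.atLeast_Suc_lessThan mult_ac)
    also have "\<dots> = (\<Sum>\<alpha>\<in>A - B. y k ^ \<alpha> k * r \<alpha>) + (\<Sum>\<alpha>\<in>B. y k ^ \<alpha> k * r \<alpha>)"
      by (rule sum.subset_diff[OF BA \<open>finite A\<close>])
    also have "(\<Sum>\<alpha>\<in>B. y k ^ \<alpha> k * r \<alpha>) = y k ^ m * (\<Sum>\<alpha>\<in>B. r \<alpha>)"
      by (simp add: sum_distrib_left B_def)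
    also have "(\<Sum>\<alpha>\<in>A - B. y k ^ \<alpha> k * r \<alpha>) = y k ^ m * (y k * s)"
      unfolding s_def sum_distrib_left
    proof (rule sum.cong[OF refl])
      fix \<alpha> assume "\<alpha> \<in> A - B"
      then have "\<alpha> k = m + Suc (\<alpha> k - m - 1)"
        using m_le[of \<alpha>] by (auto simp: B_def)
      then have "y k ^ \<alpha> k = y k ^ m * (y k * y k ^ (\<alpha> k - m - 1))"
        by (metis power_add power_Suc)
      then show "y k ^ \<alpha> k * r \<alpha> = y k ^ m * (y k * (y k ^ (\<alpha> k - m - 1) * r \<alpha>))"
        by (simp add: mult_ac)
    qed
    finally show ?thesis by (simp add: algebra_simps)
  qed
  have "(\<Sum>\<alpha>\<in>B. r \<alpha>) \<notin> P (Suc k)"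
    unfolding r_def
  proof (rule step.IH)
    show "finite B" "B \<noteq> {}" using step.prems \<alpha>\<^sub>0 by (auto simp: B_def)
    \<comment> \<open>All members of \<open>B\<close> agree at \<open>k\<close>, so they still
      differ on the shorter range.\<close>
    show "inj_on (\<lambda>\<alpha>. restrict \<alpha> {Suc k..<d}) B"
    proof (rule inj_onI)
      fix \<alpha> \<beta> assume *: "\<alpha> \<in> B" "\<beta> \<in> B" "restrict \<alpha> {Suc k..<d} = restrict \<beta> {Suc k..<d}"
      have "restrict \<alpha> {k..<d} = restrict \<beta> {k..<d}"
      proof
        fix i show "restrict \<alpha> {k..<d} i = restrict \<beta> {k..<d} i"
          using *(1,2) fun_cong[OF *(3), of i]
          by (cases "i = k"; cases "i < d") (auto simp: B_def restrict_def Suc_le_eq)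
      qed
      then show "\<alpha> = \<beta>" using inj_onD[OF step.prems(3), of \<alpha> \<beta>] *(1,2) BA by blast
    qed
    show "c \<alpha> \<noteq> 0" if "\<alpha> \<in> B" for \<alpha> using that step.prems BA by auto
  qed
  moreover have "y k * s \<in> P (Suc k)"
    using y[OF kd] primeideal_mult[OF P[of "Suc k"] _ sX, of "y k"] kd by (simp add: mult.commute)
  ultimately have "(\<Sum>\<alpha>\<in>B. r \<alpha>) + y k * s \<notin> P (Suc k)"
    using primeideal_diff[OF P[of "Suc k"], of "(\<Sum>\<alpha>\<in>B. r \<alpha>) + y k * s" "y k * s"] kd by auto
  then have "(\<Sum>\<alpha>\<in>B. r \<alpha>) + y k * s \<notin> P k" using mono[OF kd] by auto
  moreover have "y k ^ m \<notin> P k"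
    using primeideal_power[OF P[of k] yX[OF kd]] y[OF kd] kd by auto
  ultimately show ?case
    unfolding eq using primeideal_prime[OF P[of k], of "y k ^ m" "(\<Sum>\<alpha>\<in>B. r \<alpha>) + y k * s"] kd
    by (auto intro!: poly_in_power poly_in_add poly_in_mult poly_in_sum yX rX sX)
qed

section \<open>Chains of primes above the annihilator\<close>

lemma (in module) annihilator_ideal: "ideal (annihilator R M) R"
proof (rule idealI)
  show "ring R" by (rule R.ring_axioms)
  show "subgroup (annihilator R M) (add_monoid R)"
  proof (rule R.add.subgroupI)
    show "annihilator R M \<noteq> {}"
      by (auto simp: annihilator_def intro!: exI[of _ "\<zero>\<^bsub>R\<^esub>"])
    show "\<ominus>\<^bsub>R\<^esub> a \<in> annihilator R M" if "a \<in> annihilator R M" for a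
      using that by (auto simp: annihilator_def smult_l_minus)
  qed (auto simp: annihilator_def smult_l_distr)
  show "x \<otimes>\<^bsub>R\<^esub> a \<in> annihilator R M" "a \<otimes>\<^bsub>R\<^esub> x \<in> annihilator R M"
    if "a \<in> annihilator R M" "x \<in> carrier R" for a x
    using that by (auto simp: annihilator_def smult_assoc1)
qed

text \<open>A finite supremum of a nonempty set of extended naturals is attained. As
  \<open>Sup {}\<close> is 0, the hypothesis \<open>d > 0\<close> rules out the case without any
  prime ideal, as in the zero ring.\<close>

lemma krull_dim_chain:
  assumes "krull_dim R = enat d" "d > 0"
  shows "\<exists>p. (\<forall>i\<le>d. primeideal (p i) R) \<and> (\<forall>i<d. p i \<subset> p (Suc i))"
proof -
  let ?A = "{enat n | n. \<exists>p :: nat \<Rightarrow> 'a set.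
     (\<forall>i\<le>n. primeideal (p i) R) \<and> (\<forall>i<n. p i \<subset> p (Suc i))}"
  have S: "Sup ?A = enat d" using assms(1) by (simp add: krull_dim_def)
  have A: "?A \<noteq> {}"
    using S assms(2) unfolding Sup_enat_def by (metis enat_0_iff(1) less_numeral_extra(3))
  \<comment> \<open>An infinite set of extended naturals has supremum infinity.\<close>
  have fin: "finite ?A"
    using S A unfolding Sup_enat_def by (metis enat.distinct(2))
  have "Max ?A = enat d"
    using S A fin unfolding Sup_enat_def by presburger
  then have "enat d \<in> ?A"
    using Max_in[OF fin A] by presburger
  then show ?thesis by blast
qed

text \<open>Preimages under the quotient map are prime and contain \<open>I\<close>, which is mapped
  to zero; surjectivity of the map keeps the inclusions strict.\<close>

lemma (in cring) primeideal_chain_Quot: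
  assumes I: "ideal I R"
    and p: "\<And>i. i \<le> d \<Longrightarrow> primeideal (p i) (R Quot I)" "\<And>i. i < d \<Longrightarrow> p i \<subset> p (Suc i)"
  shows "\<exists>P. (\<forall>i\<le>d. primeideal (P i) R \<and> I \<subseteq> P i) \<and> (\<forall>i<d. P i \<subset> P (Suc i))"
proof -
  interpret I: ideal I R by fact
  interpret h: ring_hom_ring R "R Quot I" "(+>) I" by (rule I.rcos_ring_hom_ring)
  define P where "P i = {r \<in> carrier R. I +> r \<in> p i}" for i
  have sub: "p i \<subseteq> carrier (R Quot I)" if "i \<le> d" for i
    using p(1)[OF that] by (meson additive_subgroup.a_subset ideal.axioms(1) primeideal.axioms(1))
  have surj: "\<exists>r\<in>carrier R. I +> r = z" if "z \<in> carrier (R Quot I)" for z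
  proof -
    have "z \<in> (\<Union>a\<in>carrier R. {I +> a})"
      using that unfolding FactRing_def A_RCOSETS_def' by simp
    then show ?thesis by blast
  qed
  show ?thesis
  proof (intro exI[of _ P] conjI allI impI)
    fix i assume i: "i \<le> d"
    show "primeideal (P i) R"
      unfolding P_def by (rule h.primeideal_vimage[OF is_cring p(1)[OF i]])
    show "I \<subseteq> P i"
    proof
      fix r assume r: "r \<in> I"
      then have "I +> r = \<zero>\<^bsub>R Quot I\<^esub>"
        using I.a_rcos_const[OF r] unfolding FactRing_def by simp
      moreover have "\<zero>\<^bsub>R Quot I\<^esub> \<in> p i"
        using p(1)[OF i] by (meson additive_subgroup.zero_closed ideal.axioms(1) primeideal.axioms(1))
      ultimately show "r \<in> P i" using r I.Icarr by (simp add: P_def)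
    qed
  next
    fix i assume i: "i < d"
    obtain z where z: "z \<in> p (Suc i)" "z \<notin> p i" using p(2)[OF i] by blast
    moreover obtain r where "r \<in> carrier R" "I +> r = z"
      using surj[of z] sub[of "Suc i"] i z by (meson Suc_leI subsetD)
    ultimately have "r \<in> P (Suc i)" "r \<notin> P i" by (auto simp: P_def)
    then show "P i \<subset> P (Suc i)" using p(2)[OF i] by (auto simp: P_def)
  qed
qed

subsection \<open>Homogeneous presentations\<close>

definition poly_filter :: "(('x \<Rightarrow>\<^sub>0 nat) \<Rightarrow> bool) \<Rightarrow> ('x, 'k::field) mpoly \<Rightarrow> ('x, 'k) mpoly" where
  "poly_filter A p = (\<Sum>u\<in>{u \<in> Poly_Mapping.keys p. A u}. Poly_Mapping.single u (Poly_Mapping.lookup p u))"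

lemma lookup_poly_filter:
  "Poly_Mapping.lookup (poly_filter A p) u = (if A u then Poly_Mapping.lookup p u else 0)"
  by (auto simp: poly_filter_def lookup_sum lookup_single when_def in_keys_iff)

text \<open>The field acts through constant polynomials. All coordinate functions together form one
  vector space, in which kernel, cones and standard space can be compared by
  \<open>span\<close>.\<close>

definition fscale :: "'k::field \<Rightarrow> ('m \<Rightarrow> ('x, 'k) mpoly) \<Rightarrow> 'm \<Rightarrow> ('x, 'k) mpoly" where
  "fscale c f = (\<lambda>g. Poly_Mapping.single 0 c * f g)"

interpretation fv: vector_space fscale
proof
  fix a b :: "'k::field" and f h :: "'m \<Rightarrow> ('x, 'k) mpoly"
  show "fscale a (f + h) = fscale a f + fscale a h"
    by (simp add: fscale_def fun_eq_iff distrib_left)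
  show "fscale (a + b) f = fscale a f + fscale b f"
    by (simp add: fscale_def fun_eq_iff single_add distrib_right)
  show "fscale a (fscale b f) = fscale (a * b) f"
    by (simp add: fscale_def fun_eq_iff mult.assoc[symmetric] mult_single)
  show "fscale 1 f = f"
    by (simp add: fscale_def fun_eq_iff)
qed

lemma sum_fun_apply: "(\<Sum>i\<in>I. f i) x = (\<Sum>i\<in>I. f i x)"
  by (induction I rule: infinite_finite_induct) auto

lemma ex1_unique: "\<exists>!x. P x \<Longrightarrow> P a \<Longrightarrow> P b \<Longrightarrow> a = b"
  by blast

text \<open>Closure under negation comes from the scalar -1.\<close>

lemma (in module) submoduleI':
  assumes "H \<subseteq> carrier M" "\<zero>\<^bsub>M\<^esub> \<in> H"
    and "\<And>a b. a \<in> H \<Longrightarrow> b \<in> H \<Longrightarrow> a \<oplus>\<^bsub>M\<^esub> b \<in> H"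
    and smult: "\<And>a x. a \<in> carrier R \<Longrightarrow> x \<in> H \<Longrightarrow> a \<odot>\<^bsub>M\<^esub> x \<in> H"
  shows "submodule H R M"
proof (rule submoduleI)
  fix x assume x: "x \<in> H"
  then have "\<ominus>\<^bsub>M\<^esub> x = (\<ominus>\<^bsub>R\<^esub> \<one>\<^bsub>R\<^esub>) \<odot>\<^bsub>M\<^esub> x"
    using assms(1) smult_l_minus[OF R.one_closed, of x] by auto
  then show "\<ominus>\<^bsub>M\<^esub> x \<in> H" using smult x by simp
qed (use assms in auto)

text \<open>Zero lies in every component, so excluding it from \<open>G\<close> is what gives each
  generator a well-defined \<open>hdeg\<close>.\<close>

locale hom_gens = graded_module X M gr
  for X :: "'x set" and M :: "(('x, 'k::field) mpoly, 'm, 'w) module_scheme" (structure)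
    and gr :: "int \<Rightarrow> 'm set" +
  fixes G :: "'m set"
  assumes finite_gens: "finite G"
    and gens_hom: "G \<subseteq> (\<Union>n. gr n)"
    and gens_nonzero: "\<zero>\<^bsub>M\<^esub> \<notin> G"
    and gens_generate: "gen_submodule (mpoly_ring X) M G = carrier M"

section \<open>Homogeneous components of the module\<close>

context graded_module
begin

lemma gr_carrier: "x \<in> gr n \<Longrightarrow> x \<in> carrier M"
  using subgroup.subset[OF comp_subgroup[of n]] by auto

lemma gr_zero: "\<zero>\<^bsub>M\<^esub> \<in> gr n"
  using subgroup.one_closed[OF comp_subgroup[of n]] by simp

lemma gr_add: "x \<in> gr n \<Longrightarrow> y \<in> gr n \<Longrightarrow> x \<oplus>\<^bsub>M\<^esub> y \<in> gr n"
  using subgroup.m_closed[OF comp_subgroup[of n]] by simp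

lemma gr_finsum:
  assumes "\<And>i. i \<in> I \<Longrightarrow> f i \<in> gr n"
  shows "(\<Oplus>\<^bsub>M\<^esub>i\<in>I. f i) \<in> gr n"
  using assms
proof (induction I rule: infinite_finite_induct)
  case (insert i I)
  then have "f \<in> I \<rightarrow> carrier M" "f i \<in> carrier M" by (auto intro: gr_carrier)
  then show ?case using insert by (simp add: gr_add)
qed (simp_all add: gr_zero)

text \<open>An element of \<open>gr n\<close> is also its own decomposition, concentrated in degree
  n; uniqueness identifies the two. The index set \<open>K\<close> need only contain the support of
  \<open>c\<close>.\<close>

lemma gr_component:
  assumes c: "\<And>k. c k \<in> gr k" and K: "finite K" "\<And>k. k \<notin> K \<Longrightarrow> c k = \<zero>\<^bsub>M\<^esub>"
    and x: "x = (\<Oplus>\<^bsub>M\<^esub>k\<in>K. c k)" "x \<in> gr n"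
  shows "c k = (if k = n then x else \<zero>\<^bsub>M\<^esub>)"
proof -
  let ?c = "\<lambda>k. if k = n then x else \<zero>\<^bsub>M\<^esub>"
  have xM: "x \<in> carrier M" using x(2) by (rule gr_carrier)
  have "x = (\<Oplus>\<^bsub>M\<^esub>k\<in>{k. c k \<noteq> \<zero>\<^bsub>M\<^esub>}. c k)"
    unfolding x(1) using K c gr_carrier
    by (intro M.add.finprod_mono_neutral_cong_right) auto
  moreover have "finite {k. c k \<noteq> \<zero>\<^bsub>M\<^esub>}"
    by (rule finite_subset[OF _ K(1)]) (use K(2) in auto)
  moreover have "{k. ?c k \<noteq> \<zero>\<^bsub>M\<^esub>} = (if x = \<zero>\<^bsub>M\<^esub> then {} else {n})" by auto
  then have "x = (\<Oplus>\<^bsub>M\<^esub>k\<in>{k. ?c k \<noteq> \<zero>\<^bsub>M\<^esub>}. ?c k)" "finite {k. ?c k \<noteq> \<zero>\<^bsub>M\<^esub>}"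
    using xM by auto
  moreover have "?c k \<in> gr k" for k using x(2) gr_zero by auto
  ultimately have "c = ?c"
    using ex1_unique[OF comp_direct_sum[OF xM], of c ?c] c by presburger
  then show ?thesis by (rule fun_cong)
qed

lemma hdeg_gr:
  assumes "x \<in> gr n" "x \<noteq> \<zero>\<^bsub>M\<^esub>"
  shows "hdeg gr x = n"
  unfolding hdeg_def
proof (rule the_equality, rule assms(1))
  fix m assume m: "x \<in> gr m"
  have "(if k = m then x else \<zero>\<^bsub>M\<^esub>) \<in> gr k" for k
    using m gr_zero by simp
  \<comment> \<open>The family concentrated in degree \<open>m\<close> also sums to
    \<open>x\<close>; \<open>gr_component\<close> then evaluates its entry at
    \<open>m\<close>.\<close>
  then have "(if m = m then x else \<zero>\<^bsub>M\<^esub>) = (if m = n then x else \<zero>\<^bsub>M\<^esub>)"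
    using assms gr_carrier[OF assms(1)]
    by (intro gr_component[of "\<lambda>k. if k = m then x else \<zero>\<^bsub>M\<^esub>" "{m}"]) auto
  then show "m = n" using assms by (auto split: if_splits)
qed

end

section \<open>The free module and its graded presentation map\<close>

lemma in_free_module:
  "f \<in> carrier (free_module X G) \<longleftrightarrow> (\<forall>g\<in>G. poly_in X (f g)) \<and> (\<forall>g. g \<notin> G \<longrightarrow> f g = 0)"
  by (simp add: free_module_def)

lemma free_module_simps [simp]:
  "f \<oplus>\<^bsub>free_module X G\<^esub> h = f + h" "\<zero>\<^bsub>free_module X G\<^esub> = 0"
  "p \<odot>\<^bsub>free_module X G\<^esub> f = (\<lambda>g. p * f g)"
  by (auto simp: free_module_def fun_eq_iff)

lemma free_module_poly_in: "f \<in> carrier (free_module X G) \<Longrightarrow> poly_in X (f g)"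
  by (cases "g \<in> G") (auto simp: in_free_module)

lemma free_module_zero: "0 \<in> carrier (free_module X G)"
  by (simp add: in_free_module)

lemma free_module_add:
  "f \<in> carrier (free_module X G) \<Longrightarrow> h \<in> carrier (free_module X G) \<Longrightarrow>
    f + h \<in> carrier (free_module X G)"
  by (auto simp: in_free_module)

lemma free_module_mult:
  "f \<in> carrier (free_module X G) \<Longrightarrow> poly_in X p \<Longrightarrow> (\<lambda>g. p * f g) \<in> carrier (free_module X G)"
  by (auto simp: in_free_module)

lemma free_module_subspace: "fv.subspace (carrier (free_module X G))"
  unfolding fv.subspace_def
  by (auto simp: free_module_zero free_module_add fscale_def intro: free_module_mult)

text \<open>The epimorphism of the presentation; its kernel is \<open>pres_ker\<close>.\<close>

definition (in hom_gens) ev :: "('m \<Rightarrow> ('x, 'k) mpoly) \<Rightarrow> 'm" where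
  "ev f = (\<Oplus>\<^bsub>M\<^esub>g\<in>G. f g \<odot>\<^bsub>M\<^esub> g)"

text \<open>The projection onto the homogeneous component \<open>free_comp\<close> of degree
  \<open>k\<close>.\<close>

definition hcomp ::
  "'m set \<Rightarrow> (int \<Rightarrow> 'm set) \<Rightarrow> int \<Rightarrow> ('m \<Rightarrow> ('x, 'k::field) mpoly) \<Rightarrow> 'm \<Rightarrow> ('x, 'k) mpoly" where
  "hcomp G gr k f = (\<lambda>g. if g \<in> G then poly_filter (\<lambda>u. int (monom_deg u) + hdeg gr g = k) (f g) else 0)"

lemma lookup_hcomp:
  "Poly_Mapping.lookup (hcomp G gr k f g) u =
     (if g \<in> G \<and> int (monom_deg u) + hdeg gr g = k then Poly_Mapping.lookup (f g) u else 0)"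
  by (simp add: hcomp_def lookup_poly_filter)

lemma keys_hcomp:
  "Poly_Mapping.keys (hcomp G gr k f g) =
     {u \<in> Poly_Mapping.keys (f g). g \<in> G \<and> int (monom_deg u) + hdeg gr g = k}"
  by (auto simp: in_keys_iff lookup_hcomp split: if_splits)

lemma hcomp_sum: "hcomp G gr k (sum f I) = (\<Sum>i\<in>I. hcomp G gr k (f i))"
  by (intro ext poly_mapping_eqI)
    (auto simp: lookup_hcomp sum_fun_apply lookup_sum intro!: sum.neutral[symmetric])

lemma hcomp_free_comp:
  assumes "f \<in> carrier (free_module X G)"
  shows "hcomp G gr k f \<in> free_comp X G gr k"
proof -
  have "poly_in X (hcomp G gr k f g)" for g
    using free_module_poly_in[OF assms] by (auto simp: poly_in_def keys_hcomp)
  then show ?thesis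
    by (auto simp: free_comp_def in_free_module keys_hcomp) (simp add: hcomp_def)
qed

lemma free_comp_imp_free_module: "f \<in> free_comp X G gr k \<Longrightarrow> f \<in> carrier (free_module X G)"
  by (simp add: free_comp_def)

lemma hcomp_of_free_comp:
  assumes "f \<in> free_comp X G gr n"
  shows "hcomp G gr k f = (if k = n then f else 0)"
proof (intro ext poly_mapping_eqI)
  fix g u
  show "Poly_Mapping.lookup (hcomp G gr k f g) u = Poly_Mapping.lookup ((if k = n then f else 0) g) u"
    using assms by (cases "u \<in> Poly_Mapping.keys (f g)")
      (auto simp: lookup_hcomp free_comp_def in_free_module in_keys_iff)
qed

lemma hcomp_finite_sum:
  fixes f :: "'m \<Rightarrow> ('x, 'k::field) mpoly"
  assumes "finite G" "f \<in> carrier (free_module X G)"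
  obtains K where "finite K" "\<And>k. k \<notin> K \<Longrightarrow> hcomp G gr k f = 0" "f = (\<Sum>k\<in>K. hcomp G gr k f)"
proof
  let ?K = "\<Union>g\<in>G. (\<lambda>u. int (monom_deg u) + hdeg gr g) ` Poly_Mapping.keys (f g)"
  show fin: "finite ?K" using assms by auto
  show "hcomp G gr k f = 0" if "k \<notin> ?K" for k
  proof (intro ext poly_mapping_eqI)
    fix g u show "Poly_Mapping.lookup (hcomp G gr k f g) u = Poly_Mapping.lookup ((0 :: 'm \<Rightarrow> ('x, 'k) mpoly) g) u"
      using that by (fastforce simp: lookup_hcomp in_keys_iff)
  qed
  show "f = (\<Sum>k\<in>?K. hcomp G gr k f)"
  proof (intro ext poly_mapping_eqI)
    fix g u
    have "int (monom_deg u) + hdeg gr g \<in> ?K \<or> Poly_Mapping.lookup (f g) u = 0"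
      using assms(2) by (cases "g \<in> G") (auto 0 3 simp: in_keys_iff in_free_module)
    then have "Poly_Mapping.lookup (f g) u =
        (\<Sum>k\<in>?K. if k = int (monom_deg u) + hdeg gr g then Poly_Mapping.lookup (f g) u else 0)"
      using fin by (auto simp: sum.delta)
    also have "\<dots> = (\<Sum>k\<in>?K. Poly_Mapping.lookup (hcomp G gr k f g) u)"
      using assms(2) by (intro sum.cong refl) (auto simp: lookup_hcomp in_free_module)
    finally show "Poly_Mapping.lookup (f g) u = Poly_Mapping.lookup ((\<Sum>k\<in>?K. hcomp G gr k f) g) u"
      by (simp add: sum_fun_apply lookup_sum)
  qed
qed

context hom_gens
begin

lemma gens_carrier: "g \<in> G \<Longrightarrow> g \<in> carrier M"
  using gens_hom gr_carrier by auto

lemma gens_gr: "g \<in> G \<Longrightarrow> g \<in> gr (hdeg gr g)"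
  using gens_hom gens_nonzero hdeg_gr by (metis UN_E subsetD)

lemma ev_summand: "f \<in> carrier (free_module X G) \<Longrightarrow> g \<in> G \<Longrightarrow> f g \<odot>\<^bsub>M\<^esub> g \<in> carrier M"
  using free_module_poly_in[of f X G] gens_carrier by simp

lemma ev_closed: "f \<in> carrier (free_module X G) \<Longrightarrow> ev f \<in> carrier M"
  unfolding ev_def using ev_summand by (intro M.finsum_closed) auto

lemma ev_zero: "ev 0 = \<zero>\<^bsub>M\<^esub>"
proof -
  have "ev 0 = (\<Oplus>\<^bsub>M\<^esub>g\<in>G. \<zero>\<^bsub>M\<^esub>)"
    unfolding ev_def using smult_l_null gens_carrier by (intro M.finsum_cong) auto
  then show ?thesis by simp
qed

lemma ev_add:
  assumes "f \<in> carrier (free_module X G)" "h \<in> carrier (free_module X G)"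
  shows "ev (f + h) = ev f \<oplus>\<^bsub>M\<^esub> ev h"
proof -
  have "ev (f + h) = (\<Oplus>\<^bsub>M\<^esub>g\<in>G. f g \<odot>\<^bsub>M\<^esub> g \<oplus>\<^bsub>M\<^esub> h g \<odot>\<^bsub>M\<^esub> g)"
    unfolding ev_def
  proof (rule M.finsum_cong')
    show "(f + h) g \<odot>\<^bsub>M\<^esub> g = f g \<odot>\<^bsub>M\<^esub> g \<oplus>\<^bsub>M\<^esub> h g \<odot>\<^bsub>M\<^esub> g" if "g \<in> G" for g
      using smult_l_distr[of "f g" "h g" g] free_module_poly_in[OF assms(1)] free_module_poly_in[OF assms(2)]
        gens_carrier[OF that] by simp
  qed (use ev_summand assms in auto)
  also have "\<dots> = ev f \<oplus>\<^bsub>M\<^esub> ev h"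
    unfolding ev_def using ev_summand assms by (intro M.finsum_addf) auto
  finally show ?thesis .
qed

lemma ev_mult:
  assumes "f \<in> carrier (free_module X G)" "poly_in X p"
  shows "ev (\<lambda>g. p * f g) = p \<odot>\<^bsub>M\<^esub> ev f"
proof -
  have "ev (\<lambda>g. p * f g) = (\<Oplus>\<^bsub>M\<^esub>g\<in>G. p \<odot>\<^bsub>M\<^esub> (f g \<odot>\<^bsub>M\<^esub> g))"
    unfolding ev_def
  proof (rule M.finsum_cong')
    show "p * f g \<odot>\<^bsub>M\<^esub> g = p \<odot>\<^bsub>M\<^esub> (f g \<odot>\<^bsub>M\<^esub> g)" if "g \<in> G" for g
      using smult_assoc1[of p "f g" g] free_module_poly_in[OF assms(1)] assms(2) gens_carrier[OF that] by simp
  qed (use ev_summand assms in auto)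
  also have "\<dots> = p \<odot>\<^bsub>M\<^esub> ev f"
    unfolding ev_def using ev_summand assms finite_gens
    by (intro finsum_smult_ldistr[symmetric]) auto
  finally show ?thesis .
qed

lemma ev_sum:
  assumes "\<And>i. i \<in> I \<Longrightarrow> f i \<in> carrier (free_module X G)"
  shows "ev (sum f I) = (\<Oplus>\<^bsub>M\<^esub>i\<in>I. ev (f i))"
  using assms
proof (induction I rule: infinite_finite_induct)
  case (insert i I)
  have "(\<Sum>i\<in>I. f i) \<in> carrier (free_module X G)"
    using insert.prems by (intro fv.subspace_sum[OF free_module_subspace]) auto
  moreover have "(\<lambda>i. ev (f i)) \<in> I \<rightarrow> carrier M" using insert.prems ev_closed by auto
  ultimately have "ev (f i + sum f I) = (\<Oplus>\<^bsub>M\<^esub>i\<in>insert i I. ev (f i))"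
    using insert ev_closed by (simp add: ev_add)
  then show ?case
    unfolding sum.insert[OF insert.hyps(1,2)] .
qed (simp_all add: ev_zero)

text \<open>Vanishing coordinates contribute zero, so only generators in the support of
  \<open>f\<close> have to lie in \<open>N\<close>. This serves to show that generators are
  redundant.\<close>

lemma ev_in_submodule:
  assumes "submodule N (mpoly_ring X) M" "f \<in> carrier (free_module X G)"
    and "\<And>g. g \<in> G \<Longrightarrow> f g \<noteq> 0 \<Longrightarrow> g \<in> N"
  shows "ev f \<in> N"
proof -
  have N: "f g \<odot>\<^bsub>M\<^esub> g \<in> N" if "g \<in> G" for g
  proof (cases "f g = 0")
    case True
    then have "f g \<odot>\<^bsub>M\<^esub> g = \<zero>\<^bsub>M\<^esub>" using smult_l_null[OF gens_carrier[OF that]] by simp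
    moreover have "\<zero>\<^bsub>M\<^esub> \<in> N"
      using subgroup.one_closed[OF submodule.axioms(1)[OF assms(1)]] by simp
    ultimately show ?thesis by simp
  next
    case False
    then show ?thesis
      using submoduleE(4)[OF assms(1), of "f g" g] free_module_poly_in[OF assms(2), of g] assms(3)[OF that] by simp
  qed
  have "(\<Oplus>\<^bsub>M\<^esub>g\<in>A. f g \<odot>\<^bsub>M\<^esub> g) \<in> N" if "A \<subseteq> G" for A
    using finite_subset[OF that finite_gens] that
  proof (induction A rule: finite_induct)
    case empty
    then show ?case
      using subgroup.one_closed[OF submodule.axioms(1)[OF assms(1)]] by simp
  next
    case (insert g A)
    have "(\<lambda>g. f g \<odot>\<^bsub>M\<^esub> g) \<in> A \<rightarrow> carrier M" "f g \<odot>\<^bsub>M\<^esub> g \<in> carrier M"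
      using insert.prems ev_summand[OF assms(2)] by auto
    then show ?case
      using insert N submoduleE(5)[OF assms(1)] by simp
  qed
  then show ?thesis unfolding ev_def by simp
qed

definition basis_vec :: "'m \<Rightarrow> 'm \<Rightarrow> ('x, 'k) mpoly" where
  "basis_vec g = (\<lambda>h. if h = g then 1 else 0)"

lemma basis_vec_free_module: "g \<in> G \<Longrightarrow> basis_vec g \<in> carrier (free_module X G)"
  by (auto simp: in_free_module basis_vec_def)

lemma ev_basis_vec:
  assumes "g \<in> G"
  shows "ev (basis_vec g) = g"
proof -
  have "ev (basis_vec g) = (\<Oplus>\<^bsub>M\<^esub>h\<in>G. if g = h then h else \<zero>\<^bsub>M\<^esub>)"
    unfolding ev_def
  proof (rule M.finsum_cong')
    show "basis_vec g h \<odot>\<^bsub>M\<^esub> h = (if g = h then h else \<zero>\<^bsub>M\<^esub>)" if "h \<in> G" for h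
      using smult_one[OF gens_carrier[OF that]] smult_l_null[OF gens_carrier[OF that]]
      by (auto simp: basis_vec_def)
  qed (use gens_carrier in auto)
  also have "\<dots> = g"
    using M.add.finprod_singleton[of g G "\<lambda>h. h"] assms finite_gens gens_carrier by auto
  finally show ?thesis .
qed

text \<open>The image is a submodule containing \<open>G\<close>, hence contains the submodule
  generated by \<open>G\<close>.\<close>

lemma ev_surj: "ev ` carrier (free_module X G) = carrier M"
proof
  show "ev ` carrier (free_module X G) \<subseteq> carrier M" using ev_closed by auto
  have "submodule (ev ` carrier (free_module X G)) (mpoly_ring X) M"
  proof (rule submoduleI')
    show "ev ` carrier (free_module X G) \<subseteq> carrier M" using ev_closed by auto
    show "\<zero>\<^bsub>M\<^esub> \<in> ev ` carrier (free_module X G)"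
      using ev_zero free_module_zero[of X G] by (metis image_eqI)
    show "x \<oplus>\<^bsub>M\<^esub> y \<in> ev ` carrier (free_module X G)"
      if "x \<in> ev ` carrier (free_module X G)" "y \<in> ev ` carrier (free_module X G)" for x y
      using that by (auto simp: ev_add[symmetric] intro!: imageI free_module_add)
    show sm: "p \<odot>\<^bsub>M\<^esub> x \<in> ev ` carrier (free_module X G)"
      if "p \<in> carrier (mpoly_ring X)" "x \<in> ev ` carrier (free_module X G)" for p x
      using that by (auto simp: ev_mult[symmetric] intro!: imageI free_module_mult)
  qed
  moreover have "G \<subseteq> ev ` carrier (free_module X G)"
    using ev_basis_vec basis_vec_free_module by (metis image_eqI subsetI)
  ultimately show "carrier M \<subseteq> ev ` carrier (free_module X G)"
    unfolding gens_generate[symmetric] gen_submodule_def by blast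
qed

text \<open>A nonzero coordinate of \<open>f\<close> is homogeneous of degree \<open>k\<close> minus
  the degree of its generator, so \<open>comp_smult\<close> puts each summand into
  \<open>gr k\<close>.\<close>

lemma ev_free_comp:
  assumes "f \<in> free_comp X G gr k"
  shows "ev f \<in> gr k"
  unfolding ev_def
proof (rule gr_finsum)
  fix g assume g: "g \<in> G"
  show "f g \<odot>\<^bsub>M\<^esub> g \<in> gr k"
  proof (cases "f g = 0")
    case True
    then show ?thesis using smult_l_null[OF gens_carrier[OF g]] gr_zero by simp
  next
    case False
    then obtain u where "u \<in> Poly_Mapping.keys (f g)" by fastforce
    then have u: "int (monom_deg u) + hdeg gr g = k"
      using assms g by (simp add: free_comp_def)
    have "monom_deg v = monom_deg u" if "v \<in> Poly_Mapping.keys (f g)" for v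
      using assms g that u by (fastforce simp: free_comp_def)
    then have "f g \<in> mpoly_comp X (monom_deg u)"
      using free_module_poly_in[OF free_comp_imp_free_module[OF assms]] by (auto simp: mpoly_comp_def)
    from comp_smult[OF this gens_gr[OF g]] show ?thesis using u by simp
  qed
qed

text \<open>The map preserves degrees, so the images of the components of \<open>f\<close> decompose
  \<open>ev f\<close>, and a homogeneous element has only one decomposition.\<close>

lemma ev_hcomp:
  assumes "f \<in> carrier (free_module X G)" "ev f \<in> gr n"
  shows "ev (hcomp G gr k f) = (if k = n then ev f else \<zero>\<^bsub>M\<^esub>)"
proof -
  obtain K where K: "finite K" "\<And>k. k \<notin> K \<Longrightarrow> hcomp G gr k f = 0" "f = (\<Sum>k\<in>K. hcomp G gr k f)"
    using hcomp_finite_sum[OF finite_gens assms(1), of gr] by metis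
  have "ev f = (\<Oplus>\<^bsub>M\<^esub>k\<in>K. ev (hcomp G gr k f))"
    using ev_sum[of K "\<lambda>k. hcomp G gr k f"] free_comp_imp_free_module[OF hcomp_free_comp[OF assms(1)]] K(3) by simp
  then show ?thesis
    using gr_component[of "\<lambda>k. ev (hcomp G gr k f)" K "ev f" n k] K assms
      ev_free_comp[OF hcomp_free_comp[OF assms(1)]] ev_zero by simp
qed

text \<open>Any preimage may be replaced by its component of degree \<open>n\<close>.\<close>

lemma gr_eq_ev:
  assumes "x \<in> gr n"
  obtains f where "f \<in> free_comp X G gr n" "x = ev f"
proof -
  have "x \<in> ev ` carrier (free_module X G)" using assms ev_surj gr_carrier by auto
  then obtain f where f: "f \<in> carrier (free_module X G)" "x = ev f" by auto
  show ?thesis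
    using that[of "hcomp G gr n f"] ev_hcomp[OF f(1), of n n] f assms hcomp_free_comp[OF f(1)] by simp
qed

lemma pres_ker_iff: "f \<in> pres_ker X M G \<longleftrightarrow> f \<in> carrier (free_module X G) \<and> ev f = \<zero>\<^bsub>M\<^esub>"
  by (simp add: pres_ker_def ev_def)

text \<open>Zero is homogeneous of degree 0, and with \<open>ev f\<close> zero both branches of
  \<open>ev_hcomp\<close> vanish. Thus the kernel is graded.\<close>

lemma hcomp_pres_ker:
  assumes "f \<in> pres_ker X M G"
  shows "hcomp G gr k f \<in> pres_ker X M G"
  using assms ev_hcomp[of f 0 k] free_comp_imp_free_module[OF hcomp_free_comp] gr_zero[of 0]
  by (auto simp: pres_ker_iff)

lemma pres_ker_mult:
  assumes "f \<in> pres_ker X M G" "poly_in X p"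
  shows "(\<lambda>g. p * f g) \<in> pres_ker X M G"
  using assms by (simp add: pres_ker_iff free_module_mult ev_mult)

lemma pres_ker_subspace: "fv.subspace (pres_ker X M G)"
  unfolding fv.subspace_def
proof (intro conjI ballI allI)
  show "0 \<in> pres_ker X M G" by (simp add: pres_ker_iff free_module_zero ev_zero)
  show "f + h \<in> pres_ker X M G" if "f \<in> pres_ker X M G" "h \<in> pres_ker X M G" for f h
    using that by (simp add: pres_ker_iff free_module_add ev_add)
  show "fscale c f \<in> pres_ker X M G" if "f \<in> pres_ker X M G" for c f
    unfolding fscale_def using that by (intro pres_ker_mult) auto
qed

end

subsection \<open>Reduction to standard monomials\<close>

lemma linear_order_on_finite_max:
  assumes "linear_order_on A r" "finite B" "B \<noteq> {}" "B \<subseteq> A"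
  shows "\<exists>m\<in>B. \<forall>x\<in>B. (x, m) \<in> r"
  using assms(2-4)
proof (induction B rule: finite_ne_induct)
  case (singleton x)
  then show ?case
    using assms(1) by (auto simp: order_on_defs refl_on_def)
next
  case (insert x B)
  then obtain m where m: "m \<in> B" "\<forall>y\<in>B. (y, m) \<in> r" by auto
  have refl: "(x, x) \<in> r" and tr: "trans r" and tot: "(x, m) \<in> r \<or> (m, x) \<in> r"
    using assms(1) insert.prems insert.hyps m(1) by (auto simp: order_on_defs refl_on_def total_on_def)
  show ?case
  proof (cases "(x, m) \<in> r")
    case True
    then show ?thesis using m by blast
  next
    case False
    then have "(m, x) \<in> r" using tot by simp
    then have "\<forall>y\<in>B. (y, x) \<in> r" using m tr by (blast dest: transD)
    then show ?thesis using refl by blast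
  qed
qed

lemma lead_monI:
  assumes "linear_order_on A ord" "m \<in> mon_supp f" "\<And>m'. m' \<in> mon_supp f \<Longrightarrow> (m', m) \<in> ord"
  shows "lead_mon ord f = m"
  unfolding lead_mon_def
proof (rule the_equality)
  show "m \<in> mon_supp f \<and> (\<forall>m'\<in>mon_supp f. (m', m) \<in> ord)" using assms by blast
  fix x assume "x \<in> mon_supp f \<and> (\<forall>m'\<in>mon_supp f. (m', x) \<in> ord)"
  then have "(x, m) \<in> ord" "(m, x) \<in> ord" using assms by auto
  then show "x = m"
    using assms(1) unfolding order_on_defs by (blast dest: antisymD)
qed

lemma mon_supp_free_module:
  "f \<in> carrier (free_module X G) \<Longrightarrow> mon_supp f \<subseteq> monoms X \<times> G"
  by (fastforce simp: mon_supp_def in_free_module poly_in_def)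

lemma finite_mon_supp:
  assumes "finite G" "f \<in> carrier (free_module X G)"
  shows "finite (mon_supp f)"
proof (rule finite_subset)
  show "mon_supp f \<subseteq> (\<Union>g\<in>G. (\<lambda>u. (u, g)) ` Poly_Mapping.keys (f g))"
    using mon_supp_free_module[OF assms(2)] by (auto simp: mon_supp_def)
qed (use assms in auto)

lemma mon_supp_empty_iff: "mon_supp f = {} \<longleftrightarrow> f = (\<lambda>_. 0)"
  by (auto simp: mon_supp_def fun_eq_iff intro!: poly_mapping_eqI) (auto simp: in_keys_iff)

lemma mon_supp_mon_vec [simp]: "mon_supp (mon_vec m :: 'm \<Rightarrow> ('x, 'k::field) mpoly) = {m}"
  by (cases m) (auto simp: mon_supp_def mon_vec_def split: if_splits)

lemma mon_vec_free_module:
  assumes "m \<in> monoms X \<times> G"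
  shows "mon_vec m \<in> carrier (free_module X G)"
  using assms by (auto simp: mon_vec_def in_free_module)

lemma mon_supp_single_mult:
  "mon_supp (\<lambda>g. Poly_Mapping.single w 1 * f g) = (\<lambda>(u, g). (w + u, g)) ` mon_supp f"
  by (auto simp: mon_supp_def keys_single_mult image_iff)

lemma mon_expansion:
  fixes f :: "'m \<Rightarrow> ('x, 'k::field) mpoly"
  assumes "finite (mon_supp f)"
  shows "f = (\<Sum>m\<in>mon_supp f. fscale (Poly_Mapping.lookup (f (snd m)) (fst m)) (mon_vec m))"
proof (intro ext poly_mapping_eqI)
  fix g u
  have *: "Poly_Mapping.lookup (fscale (Poly_Mapping.lookup (f (snd m)) (fst m)) (mon_vec m) g) u =
      (if m = (u, g) then Poly_Mapping.lookup (f g) u else 0)" for m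
    by (cases m) (auto simp: fscale_def mon_vec_def mult_single lookup_single when_def)
  show "Poly_Mapping.lookup (f g) u = Poly_Mapping.lookup
      ((\<Sum>m\<in>mon_supp f. fscale (Poly_Mapping.lookup (f (snd m)) (fst m)) (mon_vec m)) g) u"
    unfolding sum_fun_apply lookup_sum * using assms
    by (simp add: sum.delta) (simp add: mon_supp_def in_keys_iff)
qed

lemma free_module_module:
  fixes X :: "'x set" and G :: "'m set"
  assumes "cring (mpoly_ring X :: ('x, 'k::field) mpoly ring)"
  shows "module (mpoly_ring X) (free_module X G :: (('x, 'k) mpoly, 'm \<Rightarrow> ('x, 'k) mpoly) module)" (is "module _ ?F")
proof (rule moduleI)
  show "abelian_group (?F)"
  proof (rule abelian_groupI)
    fix f :: "'m \<Rightarrow> ('x, 'k) mpoly" assume f: "f \<in> carrier (?F)"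
    have "- f \<in> carrier (?F)" using f by (auto simp: in_free_module)
    then show "\<exists>h\<in>carrier (?F). h \<oplus>\<^bsub>?F\<^esub> f = \<zero>\<^bsub>?F\<^esub>"
      by (intro bexI[of _ "- f"]) auto
  qed (auto simp: free_module_zero free_module_add add_ac simp del: plus_fun_apply)
qed (use assms free_module_mult in \<open>auto simp: fun_eq_iff algebra_simps\<close>)

abbreviation mdeg :: "(int \<Rightarrow> 'm set) \<Rightarrow> ('x \<Rightarrow>\<^sub>0 nat) \<times> 'm \<Rightarrow> int" where
  "mdeg gr m \<equiv> int (monom_deg (fst m)) + hdeg gr (snd m)"

lemma free_comp_iff:
  "f \<in> free_comp X G gr n \<longleftrightarrow>
     f \<in> carrier (free_module X G) \<and> (\<forall>m\<in>mon_supp f. mdeg gr m = n)"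
  using mon_supp_free_module[of f X G] by (auto simp: free_comp_def mon_supp_def)

lemma hdeg_free_comp:
  assumes "f \<in> free_comp X G gr n" "f \<noteq> (\<lambda>_. 0)"
  shows "hdeg (free_comp X G gr) f = n"
  unfolding hdeg_def
proof (rule the_equality, rule assms(1))
  fix k assume "f \<in> free_comp X G gr k"
  moreover obtain m where "m \<in> mon_supp f" using assms(2) mon_supp_empty_iff by blast
  ultimately show "k = n" using assms(1) unfolding free_comp_iff by (cases m) auto
qed

section \<open>Leading monomials of kernel elements\<close>

locale ordered_hom_gens = hom_gens X M gr G
  for X :: "'x set" and M :: "(('x, 'k::field) mpoly, 'm, 'w) module_scheme" (structure)
    and gr :: "int \<Rightarrow> 'm set" and G :: "'m set" +
  fixes ord :: "(('x \<Rightarrow>\<^sub>0 nat) \<times> 'm) rel"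
  assumes ord: "monomial_order X G ord"
begin

lemma linear_ord: "linear_order_on (monoms X \<times> G) ord"
  using ord by (simp add: monomial_order_def)

lemma lead_mon_max:
  assumes "f \<in> carrier (free_module X G)" "f \<noteq> (\<lambda>_. 0)"
  shows "lead_mon ord f \<in> mon_supp f" "m \<in> mon_supp f \<Longrightarrow> (m, lead_mon ord f) \<in> ord"
proof -
  obtain x where x: "x \<in> mon_supp f" "\<forall>m\<in>mon_supp f. (m, x) \<in> ord"
    using linear_order_on_finite_max[OF linear_ord finite_mon_supp[OF finite_gens assms(1)] _
        mon_supp_free_module[OF assms(1)]] assms(2) mon_supp_empty_iff by metis
  then have "lead_mon ord f = x" using lead_monI[OF linear_ord] by metis
  then show "lead_mon ord f \<in> mon_supp f" "m \<in> mon_supp f \<Longrightarrow> (m, lead_mon ord f) \<in> ord"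
    using x by auto
qed

text \<open>Multiplication by a monomial respects the order, so the largest monomial stays the
  largest.\<close>

lemma lead_mon_mult:
  assumes "f \<in> carrier (free_module X G)" "f \<noteq> (\<lambda>_. 0)" "w \<in> monoms X"
  shows "lead_mon ord (\<lambda>g. Poly_Mapping.single w 1 * f g) =
    (w + fst (lead_mon ord f), snd (lead_mon ord f))"
proof (rule lead_monI[OF linear_ord])
  show "(w + fst (lead_mon ord f), snd (lead_mon ord f))
      \<in> mon_supp (\<lambda>g. Poly_Mapping.single w 1 * f g)"
    using lead_mon_max(1)[OF assms(1,2)]
    by (auto simp: mon_supp_single_mult image_iff split: prod.splits intro!: bexI[of _ "lead_mon ord f"])
  fix m assume "m \<in> mon_supp (\<lambda>g. Poly_Mapping.single w 1 * f g)"
  then obtain u g where m: "m = (w + u, g)" "(u, g) \<in> mon_supp f"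
    by (auto simp: mon_supp_single_mult)
  have "((u, g), (fst (lead_mon ord f), snd (lead_mon ord f))) \<in> ord"
    using lead_mon_max(2)[OF assms(1,2) m(2)] by simp
  then show "(m, (w + fst (lead_mon ord f), snd (lead_mon ord f))) \<in> ord"
    using ord assms(3) m(1) unfolding monomial_order_def by blast
qed

text \<open>A monomial of the initial module is a monomial multiple of the leading monomial of some
  kernel element; multiplying that element by the same factor gives the required one.\<close>

lemma initial_module_monomial:
  assumes "(mon_vec m :: 'm \<Rightarrow> ('x, 'k) mpoly) \<in> initial_module X G ord (pres_ker X M G)"
  shows "\<exists>f\<in>pres_ker X M G. f \<noteq> (\<lambda>_. 0) \<and> lead_mon ord f = m"
proof -
  \<comment> \<open>\<open>D\<close> is closed under multiplication by monomials, so the elements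
    supported on \<open>D\<close> form a submodule, which bounds the initial module from
    above.\<close>
  define D where "D = {m. \<exists>f\<in>pres_ker X M G. f \<noteq> (\<lambda>_. 0) \<and>
     (\<exists>w\<in>monoms X. m = (w + fst (lead_mon ord f), snd (lead_mon ord f)))}"
  define I :: "('m \<Rightarrow> ('x, 'k) mpoly) set" where
    "I = {f \<in> carrier (free_module X G). mon_supp f \<subseteq> D}"
  interpret FM: module "mpoly_ring X" "free_module X G :: (('x, 'k) mpoly, 'm \<Rightarrow> ('x, 'k) mpoly) module"
    by (rule free_module_module[OF R.is_cring])
  have D_mult: "(w + u, g) \<in> D" if "(u, g) \<in> D" "w \<in> monoms X" for w u g
    using that unfolding D_def by (auto simp: add.assoc[symmetric])
  have "submodule I (mpoly_ring X) (free_module X G)"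
  proof (rule FM.submoduleI')
    show "I \<subseteq> carrier (free_module X G)" by (auto simp: I_def)
    show "\<zero>\<^bsub>free_module X G\<^esub> \<in> I"
      using free_module_zero[of X G] by (auto simp: I_def mon_supp_def)
    show "f \<oplus>\<^bsub>free_module X G\<^esub> h \<in> I" if "f \<in> I" "h \<in> I" for f h
    proof -
      have "mon_supp (f + h) \<subseteq> mon_supp f \<union> mon_supp h"
        using keys_add by (fastforce simp: mon_supp_def)
      then show ?thesis using that free_module_add by (auto simp: I_def simp del: plus_fun_apply)
    qed
    show "p \<odot>\<^bsub>free_module X G\<^esub> f \<in> I" if p: "p \<in> carrier (mpoly_ring X)" and f: "f \<in> I" for p f
    proof -
      have "(u, g) \<in> D" if u: "u \<in> Poly_Mapping.keys (p * f g)" for u g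
      proof -
        obtain a b where "u = a + b" "a \<in> Poly_Mapping.keys p" "b \<in> Poly_Mapping.keys (f g)"
          using keys_mult[of p "f g"] u by auto
        moreover from this have "(b, g) \<in> D" using f by (auto simp: I_def mon_supp_def)
        ultimately show ?thesis using D_mult[of b g a] p by (auto simp: poly_in_def)
      qed
      then show ?thesis using f p free_module_mult by (auto simp: I_def mon_supp_def)
    qed
  qed
  moreover have "{mon_vec (lead_mon ord f) | f. f \<in> pres_ker X M G \<and> f \<noteq> (\<lambda>_. 0)} \<subseteq> I"
  proof safe
    fix f assume f: "f \<in> pres_ker X M G" "f \<noteq> (\<lambda>_. 0)"
    have "lead_mon ord f \<in> monoms X \<times> G"
      using lead_mon_max(1)[of f] mon_supp_free_module[of f X G] f by (auto simp: pres_ker_iff)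
    moreover have "lead_mon ord f \<in> D"
      unfolding D_def using f by (intro CollectI bexI[of _ f] conjI bexI[of _ 0]) auto
    ultimately show "mon_vec (lead_mon ord f) \<in> I"
      using mon_vec_free_module[of "lead_mon ord f" X G] by (auto simp: I_def)
  qed
  ultimately have "mon_vec m \<in> I"
    using assms unfolding initial_module_def gen_submodule_def by blast
  then have "m \<in> D" by (simp add: I_def)
  then obtain f w where f: "f \<in> pres_ker X M G" "f \<noteq> (\<lambda>_. 0)" "w \<in> monoms X"
    "m = (w + fst (lead_mon ord f), snd (lead_mon ord f))"
    by (auto simp: D_def)
  let ?h = "\<lambda>g. Poly_Mapping.single w 1 * f g"
  have "?h \<in> pres_ker X M G" using f by (intro pres_ker_mult) auto
  moreover have "?h \<noteq> (\<lambda>_. 0)"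
    using f(2) unfolding mon_supp_empty_iff[symmetric] by (simp add: mon_supp_single_mult)
  moreover have "lead_mon ord ?h = m"
    using lead_mon_mult[of f w] f by (simp add: pres_ker_iff)
  ultimately show ?thesis by blast
qed

text \<open>The kernel is graded, so a kernel element with leading monomial \<open>m\<close> may be
  replaced by its component in the degree of \<open>m\<close>. This keeps \<open>m\<close> and only
  drops other monomials, so \<open>m\<close> remains the largest.\<close>

lemma initial_module_monomial_homogeneous:
  assumes "(mon_vec m :: 'm \<Rightarrow> ('x, 'k) mpoly) \<in> initial_module X G ord (pres_ker X M G)"
  obtains f where "f \<in> pres_ker X M G" "f \<in> free_comp X G gr (mdeg gr m)" "m \<in> mon_supp f"
    "\<And>m'. m' \<in> mon_supp f \<Longrightarrow> (m', m) \<in> ord"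
proof -
  obtain f where f: "f \<in> pres_ker X M G" "f \<noteq> (\<lambda>_. 0)" "lead_mon ord f = m"
    using initial_module_monomial[OF assms] by blast
  have fF: "f \<in> carrier (free_module X G)" using f by (simp add: pres_ker_iff)
  note max = lead_mon_max[OF fF f(2), unfolded f(3)]
  have supp: "mon_supp (hcomp G gr k f) = {m \<in> mon_supp f. mdeg gr m = k}" for k
    using mon_supp_free_module[OF fF] by (auto simp: mon_supp_def keys_hcomp)
  show ?thesis
    using that[of "hcomp G gr (mdeg gr m) f"] hcomp_pres_ker[OF f(1)] hcomp_free_comp[OF fF] max
    by (simp add: supp)
qed

lemma finite_monomials: "finite {m \<in> monoms X \<times> G. mdeg gr m \<le> k}"
proof (rule finite_subset)
  show "{m \<in> monoms X \<times> G. mdeg gr m \<le> k} \<subseteq>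
      (\<Union>g\<in>G. {u \<in> monoms X. monom_deg u \<le> nat (k - hdeg gr g)} \<times> {g})"
    by auto
  show "finite (\<Union>g\<in>G. {u \<in> monoms X. monom_deg u \<le> nat (k - hdeg gr g)} \<times> {g})"
    using finite_gens monoms_le_count(1)[OF finite_vars] by auto
qed

text \<open>As the kernel is graded, the reduction stays within the finitely many monomials of one
  degree, so it terminates without Dickson's lemma.\<close>

lemma monomial_reduction:
  fixes m
  defines "S k \<equiv> standard_space X G ord (pres_ker X M G) \<inter> free_comp X G gr k"
  assumes "m \<in> monoms X \<times> G"
  shows "mon_vec m \<in> fv.span (S (mdeg gr m) \<union> pres_ker X M G)"
  using assms(2)
\<comment> \<open>The measure counts the monomials up to \<open>m\<close> in the order whose degree
  is at most that of \<open>m\<close>. Passing to a smaller monomial of equal degree loses at least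
  \<open>m\<close> itself.\<close>
proof (induction m rule: measure_induct_rule[of
      "\<lambda>m. card {m' \<in> monoms X \<times> G. mdeg gr m' \<le> mdeg gr m \<and> (m', m) \<in> ord}"])
  case (less m)
  let ?W = "S (mdeg gr m) \<union> pres_ker X M G"
  let ?I = "initial_module X G ord (pres_ker X M G)"
  show ?case
  proof (cases "(mon_vec m :: 'm \<Rightarrow> ('x, 'k) mpoly) \<in> ?I")
    case False
    then have "mon_vec m \<in> S (mdeg gr m)"
      using mon_vec_free_module[OF less.prems]
      by (simp add: S_def standard_space_def free_comp_iff)
    then show ?thesis by (simp add: fv.span_base)
  next
    case True
    then obtain f where f: "f \<in> pres_ker X M G" "f \<in> free_comp X G gr (mdeg gr m)" "m \<in> mon_supp f"
      "\<And>m'. m' \<in> mon_supp f \<Longrightarrow> (m', m) \<in> ord"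
      by (rule initial_module_monomial_homogeneous) blast
    have fF: "f \<in> carrier (free_module X G)" using f(2) by (rule free_comp_imp_free_module)
    have smaller: "mon_vec m' \<in> fv.span ?W" if m': "m' \<in> mon_supp f" "m' \<noteq> m" for m'
    proof -
      have deg: "mdeg gr m' = mdeg gr m" using f(2) m' by (simp add: free_comp_iff)
      have mX: "m' \<in> monoms X \<times> G" using mon_supp_free_module[OF fF] m' by auto
      have ord': "(m', m) \<in> ord" "(m, m') \<notin> ord" "(m, m) \<in> ord" "trans ord"
        using f(4)[OF m'(1)] linear_ord m'(2) less.prems
        by (auto simp: order_on_defs refl_on_def dest: antisymD)
      have "card {x \<in> monoms X \<times> G. mdeg gr x \<le> mdeg gr m' \<and> (x, m') \<in> ord} <
          card {x \<in> monoms X \<times> G. mdeg gr x \<le> mdeg gr m \<and> (x, m) \<in> ord}"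
      proof (rule psubset_card_mono)
        show "finite {x \<in> monoms X \<times> G. mdeg gr x \<le> mdeg gr m \<and> (x, m) \<in> ord}"
          by (rule finite_subset[OF _ finite_monomials[of "mdeg gr m"]]) blast
        show "{x \<in> monoms X \<times> G. mdeg gr x \<le> mdeg gr m' \<and> (x, m') \<in> ord} \<subset>
            {x \<in> monoms X \<times> G. mdeg gr x \<le> mdeg gr m \<and> (x, m) \<in> ord}"
        proof
          show "{x \<in> monoms X \<times> G. mdeg gr x \<le> mdeg gr m' \<and> (x, m') \<in> ord} \<subseteq>
            {x \<in> monoms X \<times> G. mdeg gr x \<le> mdeg gr m \<and> (x, m) \<in> ord}"
            unfolding deg using ord' by (blast dest: transD)
          have "m \<in> {x \<in> monoms X \<times> G. mdeg gr x \<le> mdeg gr m \<and> (x, m) \<in> ord}"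
            "m \<notin> {x \<in> monoms X \<times> G. mdeg gr x \<le> mdeg gr m' \<and> (x, m') \<in> ord}"
            using less.prems ord' by auto
          then show "{x \<in> monoms X \<times> G. mdeg gr x \<le> mdeg gr m' \<and> (x, m') \<in> ord} \<noteq>
            {x \<in> monoms X \<times> G. mdeg gr x \<le> mdeg gr m \<and> (x, m) \<in> ord}"
            by metis
        qed
      qed
      from less.IH[OF this mX] show ?thesis unfolding deg .
    qed
    let ?c = "\<lambda>m. Poly_Mapping.lookup (f (snd m)) (fst m)"
    let ?r = "\<Sum>m'\<in>mon_supp f - {m}. fscale (?c m') (mon_vec m')"
    \<comment> \<open>Solve the expansion of \<open>f\<close> for its leading term: \<open>f\<close>
      lies in the kernel and the other monomials are covered by induction.\<close>
    have "f = (\<Sum>m'\<in>mon_supp f. fscale (?c m') (mon_vec m'))"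
      by (rule mon_expansion[OF finite_mon_supp[OF finite_gens fF]])
    also have "\<dots> = fscale (?c m) (mon_vec m) + ?r"
      by (rule sum.remove[OF finite_mon_supp[OF finite_gens fF] f(3)])
    finally have "fscale (?c m) (mon_vec m) = f - ?r"
      by (subst eq_diff_eq) (rule sym)
    moreover have "f - ?r \<in> fv.span ?W"
      using f(1) smaller by (intro fv.span_diff fv.span_sum fv.span_scale) (auto intro: fv.span_base)
    moreover have "?c m \<noteq> 0" using f(3) by (auto simp: mon_supp_def in_keys_iff)
    then have "mon_vec m = fscale (inverse (?c m)) (fscale (?c m) (mon_vec m))"
      by simp
    ultimately have "mon_vec m = fscale (inverse (?c m)) (f - ?r)" "f - ?r \<in> fv.span ?W"
      by simp_all
    then show ?thesis using fv.span_scale[of "f - ?r" ?W "inverse (?c m)"] by simp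
  qed
qed

end

subsection \<open>Dimension of cones\<close>

definition deg_le :: "nat \<Rightarrow> ('x, 'k::field) mpoly \<Rightarrow> bool" where
  "deg_le n p \<longleftrightarrow> (\<forall>u\<in>Poly_Mapping.keys p. monom_deg u \<le> n)"

lemma deg_le_exists: "\<exists>n. deg_le n p"
proof -
  have "deg_le (\<Sum>u\<in>Poly_Mapping.keys p. monom_deg u) p"
    unfolding deg_le_def by (auto intro!: member_le_sum)
  then show ?thesis by blast
qed

lemma deg_le_mono: "deg_le m p \<Longrightarrow> m \<le> n \<Longrightarrow> deg_le n p"
  by (auto simp: deg_le_def)

lemma deg_le_1: "deg_le 0 1"
  by (simp add: deg_le_def)

lemma deg_le_mult:
  assumes "deg_le m p" "deg_le n q"
  shows "deg_le (m + n) (p * q)"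
  unfolding deg_le_def
proof
  fix u assume "u \<in> Poly_Mapping.keys (p * q)"
  then obtain a b where "u = a + b" "a \<in> Poly_Mapping.keys p" "b \<in> Poly_Mapping.keys q"
    using keys_mult[of p q] by blast
  then show "monom_deg u \<le> m + n" using assms by (auto simp: deg_le_def intro: add_mono)
qed

lemma deg_le_power: "deg_le m p \<Longrightarrow> deg_le (n * m) (p ^ n)"
  by (induction n) (auto simp: deg_le_1 intro: deg_le_mult)

lemma deg_le_prod:
  assumes "finite I" "\<And>i. i \<in> I \<Longrightarrow> deg_le (m i) (f i)"
  shows "deg_le (sum m I) (prod f I)"
  using assms by (induction I rule: finite_induct) (auto simp: deg_le_1 intro: deg_le_mult)

text \<open>Expanding \<open>p\<close> into monomials splits the cone element into homogeneous
  multiples of \<open>h\<close>; the projection keeps those of degree \<open>k\<close> and kills the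
  others.\<close>

lemma hcomp_cone:
  fixes h :: "'m \<Rightarrow> ('x, 'k::field) mpoly"
  assumes h: "h \<in> free_comp X G gr n" and "U \<subseteq> X" and p: "poly_in U p"
  shows "hcomp G gr k (\<lambda>g. p * h g) \<in>
    fv.span {(\<lambda>g. Poly_Mapping.single u 1 * h g) | u. u \<in> monoms U \<and> int (monom_deg u) + n = k}"
    (is "_ \<in> fv.span ?B")
proof -
  let ?s = "\<lambda>u g. Poly_Mapping.single u 1 * h g"
  have "(\<lambda>g. p * h g) = (\<Sum>u\<in>Poly_Mapping.keys p. fscale (Poly_Mapping.lookup p u) (?s u))"
  proof
    fix g
    have "p * h g =
        (\<Sum>u\<in>Poly_Mapping.keys p. Poly_Mapping.single u (Poly_Mapping.lookup p u)) * h g"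
      using poly_mapping_sum_single[of p] by metis
    also have "\<dots> = (\<Sum>u\<in>Poly_Mapping.keys p. fscale (Poly_Mapping.lookup p u) (?s u) g)"
      by (simp add: sum_distrib_right fscale_def mult.assoc[symmetric] mult_single)
    finally show "p * h g = (\<Sum>u\<in>Poly_Mapping.keys p. fscale (Poly_Mapping.lookup p u) (?s u)) g"
      by (simp add: sum_fun_apply)
  qed
  then have "hcomp G gr k (\<lambda>g. p * h g) =
      (\<Sum>u\<in>Poly_Mapping.keys p. hcomp G gr k (fscale (Poly_Mapping.lookup p u) (?s u)))"
    by (simp only: hcomp_sum)
  also have "\<dots> \<in> fv.span ?B"
  proof (rule fv.span_sum)
    fix u assume u: "u \<in> Poly_Mapping.keys p"
    let ?t = "fscale (Poly_Mapping.lookup p u) (?s u)"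
    have uU: "u \<in> monoms U" using u p by (auto simp: poly_in_def)
    then have uX: "u \<in> monoms X" using \<open>U \<subseteq> X\<close> by (auto simp: monoms_def)
    have "?s u \<in> carrier (free_module X G)"
      using free_comp_imp_free_module[OF h] uX by (intro free_module_mult) auto
    then have "?s u \<in> free_comp X G gr (int (monom_deg u) + n)"
      using h by (auto simp: free_comp_iff mon_supp_single_mult)
    moreover have "?t \<in> carrier (free_module X G)"
      unfolding fscale_def by (rule free_module_mult[OF free_comp_imp_free_module[OF calculation]]) simp
    ultimately have t: "?t \<in> free_comp X G gr (int (monom_deg u) + n)"
      using u by (auto simp: free_comp_def fscale_def keys_single_mult in_keys_iff)
    show "hcomp G gr k ?t \<in> fv.span ?B"
    proof (cases "k = int (monom_deg u) + n")
      case True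
      have "?s u \<in> ?B" using uU True by blast
      then show ?thesis
        using hcomp_of_free_comp[OF t, of k] True by (simp add: fv.span_scale fv.span_base)
    next
      case False
      then have "hcomp G gr k ?t = 0" using hcomp_of_free_comp[OF t, of k] by simp
      then show ?thesis by (simp only: fv.span_zero)
    qed
  qed
  finally show ?thesis .
qed

text \<open>With \<open>dg\<close> the degree of the generators, a spanning set for the parts of all
  cones in degrees up to \<open>N\<close>.\<close>

definition cone_monomials ::
  "(('m \<Rightarrow> ('x, 'k::field) mpoly) \<Rightarrow> int) \<Rightarrow> ('m, 'x, 'k) cones \<Rightarrow> int \<Rightarrow> ('m \<Rightarrow> ('x, 'k) mpoly) set"
  where
  "cone_monomials dg P N = (\<Union>(h, U)\<in>set P.
     {(\<lambda>g. Poly_Mapping.single u 1 * h g) | u. u \<in> monoms U \<and> int (monom_deg u) + dg h \<le> N})"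

text \<open>Each cone contributes at most \<open>Suc K ^ r\<close> elements, one for each monomial
  of degree at most \<open>K\<close> in its variables. In the application \<open>r\<close> is
  \<open>d - 1\<close> and \<open>K\<close> grows linearly.\<close>

lemma cone_monomials_card:
  assumes "\<And>h U. (h, U) \<in> set P \<Longrightarrow> finite U \<and> card U \<le> r \<and> N - dg h \<le> int K"
  shows "finite (cone_monomials dg P N)"
    and "card (cone_monomials dg P N) \<le> card (set P) * Suc K ^ r"
proof -
  let ?T = "\<lambda>(h, U). {(\<lambda>g. Poly_Mapping.single u 1 * h g) | u. u \<in> monoms U \<and> int (monom_deg u) + dg h \<le> N}"
  have T: "finite (?T x) \<and> card (?T x) \<le> Suc K ^ r" if x_in: "x \<in> set P" for x
  proof -
    obtain h U where x: "x = (h, U)" by (cases x)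
    note hU = assms[OF x_in[unfolded x]]
    let ?M = "{u \<in> monoms U. monom_deg u \<le> K}"
    have sub: "?T x \<subseteq> (\<lambda>u g. Poly_Mapping.single u 1 * h g) ` ?M"
      using hU by (auto simp: x)
    have fin: "finite ?M" "card ?M \<le> Suc K ^ card U"
      using monoms_le_count[of U K] hU by auto
    have "card (?T x) \<le> card ?M"
      by (rule order_trans[OF card_mono[OF finite_imageI[OF fin(1)] sub] card_image_le[OF fin(1)]])
    also have "\<dots> \<le> Suc K ^ r" using fin(2) hU power_increasing[of "card U" r "Suc K"] by simp
    finally show ?thesis using finite_subset[OF sub] fin(1) by simp
  qed
  have eq: "cone_monomials dg P N = (\<Union>x\<in>set P. ?T x)"
    by (simp add: cone_monomials_def)
  show "finite (cone_monomials dg P N)" unfolding eq using T by blast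
  have "card (cone_monomials dg P N) \<le> (\<Sum>x\<in>set P. card (?T x))"
    unfolding eq by (rule card_UN_le) simp
  also have "\<dots> \<le> (\<Sum>x\<in>set P. Suc K ^ r)" using T by (intro sum_mono) blast
  finally show "card (cone_monomials dg P N) \<le> card (set P) * Suc K ^ r" by simp
qed

context hom_gens
begin

text \<open>A prime containing the intersection of the annihilators of the generators contains one of
  them; this reduces the dimension count to a single generator.\<close>

lemma primeideal_annihilator_gen:
  assumes "primeideal p (mpoly_ring X)" "annihilator (mpoly_ring X) M \<subseteq> p"
  shows "\<exists>g\<in>G. \<forall>s. poly_in X s \<longrightarrow> s \<odot>\<^bsub>M\<^esub> g = \<zero>\<^bsub>M\<^esub> \<longrightarrow> s \<in> p"
proof (rule ccontr)
  assume "\<not> ?thesis"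
  then have "\<exists>s. poly_in X s \<and> s \<odot>\<^bsub>M\<^esub> g = \<zero>\<^bsub>M\<^esub> \<and> s \<notin> p" if "g \<in> G" for g
    using that by blast
  then obtain s where s: "\<And>g. g \<in> G \<Longrightarrow> poly_in X (s g)" "\<And>g. g \<in> G \<Longrightarrow> s g \<odot>\<^bsub>M\<^esub> g = \<zero>\<^bsub>M\<^esub>"
    "\<And>g. g \<in> G \<Longrightarrow> s g \<notin> p" by metis
  \<comment> \<open>The product kills every generator, hence all of \<open>M\<close>; primeness then
    puts one of the factors into \<open>p\<close>.\<close>
  let ?s = "\<Prod>g\<in>G. s g"
  have sX: "poly_in X ?s" using s(1) by (rule poly_in_prod)
  have gen: "?s \<odot>\<^bsub>M\<^esub> g = \<zero>\<^bsub>M\<^esub>" if "g \<in> G" for g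
  proof -
    have rX: "poly_in X (prod s (G - {g}))" using s(1) by (intro poly_in_prod) auto
    have "?s = prod s (G - {g}) * s g"
      using prod.remove[OF finite_gens that, of s] by (simp add: mult.commute)
    then show ?thesis
      using smult_assoc1[of "prod s (G - {g})" "s g" g] rX s(1,2)[OF that] gens_carrier[OF that]
        smult_r_null[of "prod s (G - {g})"] by simp
  qed
  have "?s \<odot>\<^bsub>M\<^esub> x = \<zero>\<^bsub>M\<^esub>" if x: "x \<in> carrier M" for x
  proof -
    obtain f where f: "f \<in> carrier (free_module X G)" "x = ev f"
      using x unfolding ev_surj[symmetric] by blast
    have "?s \<odot>\<^bsub>M\<^esub> x = (\<Oplus>\<^bsub>M\<^esub>g\<in>G. ?s \<odot>\<^bsub>M\<^esub> (f g \<odot>\<^bsub>M\<^esub> g))"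
      unfolding f(2) ev_def using finite_gens sX ev_summand[OF f(1)]
      by (intro finsum_smult_ldistr) auto
    also have "\<dots> = (\<Oplus>\<^bsub>M\<^esub>g\<in>G. \<zero>\<^bsub>M\<^esub>)"
    proof (rule M.finsum_cong')
      fix g assume g: "g \<in> G"
      have "?s \<odot>\<^bsub>M\<^esub> (f g \<odot>\<^bsub>M\<^esub> g) = (f g * ?s) \<odot>\<^bsub>M\<^esub> g"
        using smult_assoc1[of ?s "f g" g] sX free_module_poly_in[OF f(1)] gens_carrier[OF g]
        by (simp add: mult.commute)
      also have "\<dots> = f g \<odot>\<^bsub>M\<^esub> \<zero>\<^bsub>M\<^esub>"
        using smult_assoc1[of "f g" ?s g] sX free_module_poly_in[OF f(1)] gens_carrier[OF g] gen[OF g] by simp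
      finally show "?s \<odot>\<^bsub>M\<^esub> (f g \<odot>\<^bsub>M\<^esub> g) = \<zero>\<^bsub>M\<^esub>"
        using smult_r_null[of "f g"] free_module_poly_in[OF f(1)] by simp
    qed auto
    finally show ?thesis by simp
  qed
  then have "?s \<in> p" using assms(2) sX by (auto simp: annihilator_def)
  then obtain g where "g \<in> G" "s g \<in> p"
    using primeideal_prod[OF assms(1), of G s] s(1) by blast
  then show False using s(3) by blast
qed

text \<open>Polynomials have no negative degrees, so a homogeneous preimage of \<open>x\<close>
  involves only generators of degree at most \<open>n\<close>.\<close>

lemma gr_in_submodule:
  assumes "x \<in> gr n" "submodule N (mpoly_ring X) M" "\<And>g. g \<in> G \<Longrightarrow> hdeg gr g \<le> n \<Longrightarrow> g \<in> N"
  shows "x \<in> N"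
proof -
  obtain f where f: "f \<in> free_comp X G gr n" "x = ev f" using gr_eq_ev[OF assms(1)] .
  show ?thesis
    unfolding f(2)
  proof (rule ev_in_submodule[OF assms(2) free_comp_imp_free_module[OF f(1)]])
    fix g assume g: "g \<in> G" "f g \<noteq> 0"
    then obtain u where "u \<in> Poly_Mapping.keys (f g)" by fastforce
    then show "g \<in> N" using f(1) g(1) assms(3)[OF g(1)] by (fastforce simp: free_comp_def)
  qed
qed

end

section \<open>Degrees of minimal generators\<close>

lemma gen_submodule_subset_cong:
  assumes "\<And>N. submodule N R M \<Longrightarrow> A \<subseteq> N \<longleftrightarrow> B \<subseteq> N"
  shows "gen_submodule R M A = gen_submodule R M B"
  unfolding gen_submodule_def using assms by metis

text \<open>The last hypothesis places \<open>g\<close> in the submodule generated by the other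
  generators, so \<open>G - {g}\<close> would still generate.\<close>

lemma min_hom_gens_redundant:
  assumes "min_hom_gens R M gr G" "g \<in> G"
    and "\<And>N. submodule N R M \<Longrightarrow> G - {g} \<subseteq> N \<Longrightarrow> g \<in> N"
  shows False
proof -
  have "gen_submodule R M (G - {g}) = gen_submodule R M G"
    using assms(2,3) by (intro gen_submodule_subset_cong) blast
  moreover have "G - {g} \<subset> G" using assms(2) by blast
  ultimately show False using assms(1) unfolding min_hom_gens_def by metis
qed

lemma (in graded_module) min_hom_gens_hom_gens:
  assumes "min_hom_gens (mpoly_ring X) M gr G"
  shows "hom_gens X M gr G"
proof
  show "\<zero>\<^bsub>M\<^esub> \<notin> G"
  proof
    assume "\<zero>\<^bsub>M\<^esub> \<in> G"
    moreover have "\<zero>\<^bsub>M\<^esub> \<in> N" if "submodule N (mpoly_ring X) M" for N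
      using subgroup.one_closed[OF submodule.axioms(1)[OF that]] by simp
    ultimately show False using min_hom_gens_redundant[OF assms] by blast
  qed
qed (use assms in \<open>auto simp: min_hom_gens_def\<close>)

text \<open>If \<open>G\<close> had no element in the degree of \<open>g\<close>, then
  \<open>g\<close> would be generated by elements of \<open>G\<close> of smaller degree, and these
  by elements of \<open>G'\<close> of smaller degree, hence other than \<open>g\<close>. So all
  minimal generating sets have the same degrees, and \<open>e_plus\<close> can be read off from one
  of them.\<close>

lemma (in hom_gens) min_hom_gens_degree:
  assumes "min_hom_gens (mpoly_ring X) M gr G'" "g \<in> G'"
  shows "hdeg gr g \<in> hdeg gr ` G"
proof (rule ccontr)
  assume contr: "hdeg gr g \<notin> hdeg gr ` G"
  interpret G': hom_gens X M gr G' by (rule min_hom_gens_hom_gens[OF assms(1)])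
  show False
  proof (rule min_hom_gens_redundant[OF assms])
    fix N assume N: "submodule N (mpoly_ring X) M" "G' - {g} \<subseteq> N"
    show "g \<in> N"
    proof (rule gr_in_submodule[OF G'.gens_gr[OF assms(2)] N(1)])
      fix h assume h: "h \<in> G" "hdeg gr h \<le> hdeg gr g"
      then have "hdeg gr h < hdeg gr g" using contr by (metis image_eqI order_le_less)
      then show "h \<in> N"
        using N(2) by (intro G'.gr_in_submodule[OF gens_gr[OF h(1)] N(1)]) auto
    qed
  qed
qed

lemma (in graded_module) e_plus_eq:
  assumes "min_hom_gens (mpoly_ring X) M gr G"
  shows "e_plus (mpoly_ring X) M gr = Max (hdeg gr ` G)"
proof -
  interpret hom_gens X M gr G by (rule min_hom_gens_hom_gens[OF assms])
  have "{hdeg gr g | g. \<exists>G. min_hom_gens (mpoly_ring X) M gr G \<and> g \<in> G} = hdeg gr ` G"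
    using min_hom_gens_degree assms by blast
  then show ?thesis by (simp add: e_plus_def)
qed

lemma (in hom_gens) gens_nonempty:
  assumes "carrier M \<noteq> {\<zero>\<^bsub>M\<^esub>}"
  shows "G \<noteq> {}"
proof
  assume "G = {}"
  then have "ev f = \<zero>\<^bsub>M\<^esub>" for f unfolding ev_def by simp
  then have "carrier M \<subseteq> {\<zero>\<^bsub>M\<^esub>}" unfolding ev_surj[symmetric] by blast
  then show False using assms M.zero_closed by blast
qed

section \<open>Comparing cones with the module\<close>

context ordered_hom_gens
begin

lemma cone_decomposition_sum:
  assumes "cone_decomposition X M gr G ord P" "f \<in> standard_space X G ord (pres_ker X M G)"
  obtains c where "\<And>i. i < length P \<Longrightarrow> c i \<in> cone (fst (P ! i)) (snd (P ! i))"
    "f = (\<lambda>g. \<Sum>i<length P. c i g)"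
proof -
  obtain c where "c \<in> (\<Pi>\<^sub>E i\<in>{..<length P}. cone (fst (P ! i)) (snd (P ! i)))"
    "f = (\<lambda>g. \<Sum>i<length P. c i g)"
    using assms unfolding cone_decomposition_def by blast
  then show ?thesis using that[of c] by auto
qed

lemma cone_generator:
  assumes "cone_decomposition X M gr G ord P" "(h, U) \<in> set P"
  shows "h \<in> free_comp X G gr (hdeg (free_comp X G gr) h)" "U \<subseteq> X"
proof -
  have "\<forall>(h, U)\<in>set P. h \<noteq> (\<lambda>_. 0) \<and> (\<exists>n. h \<in> free_comp X G gr n) \<and> U \<subseteq> X \<and>
      cone h U \<subseteq> standard_space X G ord (pres_ker X M G)"
    using assms(1) unfolding cone_decomposition_def by (rule conjunct1)
  from bspec[OF this assms(2)]
  obtain n where "h \<noteq> (\<lambda>_. 0)" "h \<in> free_comp X G gr n" "U \<subseteq> X"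
    by auto
  then show "h \<in> free_comp X G gr (hdeg (free_comp X G gr) h)" "U \<subseteq> X"
    using hdeg_free_comp by metis+
qed

text \<open>Taking components of degree \<open>k\<close> in the decomposition of \<open>f\<close>
  leaves in each cone only monomial multiples of its generator in that degree.\<close>

lemma standard_space_span:
  assumes P: "cone_decomposition X M gr G ord P"
    and f: "f \<in> standard_space X G ord (pres_ker X M G)" "f \<in> free_comp X G gr k" and "k \<le> N"
  shows "f \<in> fv.span (cone_monomials (hdeg (free_comp X G gr)) P N)"
proof -
  obtain c where c: "\<And>i. i < length P \<Longrightarrow> c i \<in> cone (fst (P ! i)) (snd (P ! i))"
    "f = (\<lambda>g. \<Sum>i<length P. c i g)"
    using cone_decomposition_sum[OF P f(1)] by blast
  have "f = (\<Sum>i<length P. c i)"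
    unfolding c(2) by (simp add: fun_eq_iff sum_fun_apply)
  moreover have "f = hcomp G gr k f" using hcomp_of_free_comp[OF f(2), of k] by simp
  ultimately have "f = (\<Sum>i<length P. hcomp G gr k (c i))" using hcomp_sum by metis
  also have "\<dots> \<in> fv.span (cone_monomials (hdeg (free_comp X G gr)) P N)"
  proof (rule fv.span_sum)
    fix i assume "i \<in> {..<length P}"
    then have i: "i < length P" by simp
    obtain h U where hU: "P ! i = (h, U)" by (cases "P ! i")
    then have hP: "(h, U) \<in> set P" using i nth_mem by metis
    obtain p where p: "poly_in U p" "c i = (\<lambda>g. p * h g)"
      using c(1)[OF i] by (auto simp: hU cone_def)
    have "{(\<lambda>g. Poly_Mapping.single u 1 * h g) | u. u \<in> monoms U \<and>
        int (monom_deg u) + hdeg (free_comp X G gr) h = k} \<subseteq> cone_monomials (hdeg (free_comp X G gr)) P N"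
      using hP \<open>k \<le> N\<close> unfolding cone_monomials_def by blast
    from fv.span_mono[OF this] show "hcomp G gr k (c i) \<in> fv.span (cone_monomials (hdeg (free_comp X G gr)) P N)"
      using hcomp_cone[OF cone_generator[OF P hP] p(1), of k] unfolding p(2) by blast
  qed
  finally show ?thesis .
qed

text \<open>Modulo the kernel every monomial reduces to standard elements of its own degree, and
  these are covered by the cones.\<close>

lemma free_module_span:
  assumes P: "cone_decomposition X M gr G ord P"
    and f: "f \<in> carrier (free_module X G)" "\<And>m. m \<in> mon_supp f \<Longrightarrow> mdeg gr m \<le> N"
  shows "f \<in> fv.span (cone_monomials (hdeg (free_comp X G gr)) P N \<union> pres_ker X M G)"
    (is "_ \<in> fv.span ?B")
proof -
  have "mon_vec m \<in> fv.span ?B" if m: "m \<in> mon_supp f" for m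
  proof -
    let ?S = "standard_space X G ord (pres_ker X M G) \<inter> free_comp X G gr (mdeg gr m)"
    have "?S \<union> pres_ker X M G \<subseteq> fv.span ?B"
    proof (intro Un_least subsetI)
      fix h assume "h \<in> ?S"
      then have "h \<in> fv.span (cone_monomials (hdeg (free_comp X G gr)) P N)"
        using standard_space_span[OF P _ _ f(2)[OF m]] by blast
      then show "h \<in> fv.span ?B" using fv.span_mono[of _ ?B] by blast
    next
      fix h assume "h \<in> pres_ker X M G"
      then show "h \<in> fv.span ?B" by (simp add: fv.span_base)
    qed
    then have "fv.span (?S \<union> pres_ker X M G) \<subseteq> fv.span ?B"
      by (rule fv.span_minimal) (rule fv.subspace_span)
    moreover have "mon_vec m \<in> fv.span (?S \<union> pres_ker X M G)"
      using mon_supp_free_module[OF f(1)] m by (intro monomial_reduction) blast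
    ultimately show ?thesis by blast
  qed
  then have "(\<Sum>m\<in>mon_supp f. fscale (Poly_Mapping.lookup (f (snd m)) (fst m)) (mon_vec m)) \<in> fv.span ?B"
    by (intro fv.span_sum fv.span_scale)
  then show ?thesis using mon_expansion[OF finite_mon_supp[OF finite_gens f(1)]] by metis
qed

lemma cone_of_large_dimension:
  assumes P: "cone_decomposition X M gr G ord P"
    and dim: "module_dim (mpoly_ring X) M = enat d" and "d > 0"
  shows "\<exists>(h, U)\<in>set P. d \<le> card U"
proof (rule ccontr)
  assume contr: "\<not> ?thesis"
  let ?dg = "hdeg (free_comp X G gr) :: ('m \<Rightarrow> ('x, 'k) mpoly) \<Rightarrow> int"
  obtain p where "\<And>i. i \<le> d \<Longrightarrow> primeideal (p i) (mpoly_ring X Quot annihilator (mpoly_ring X) M)"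
    "\<And>i. i < d \<Longrightarrow> p i \<subset> p (Suc i)"
    using krull_dim_chain[OF dim[unfolded module_dim_def] \<open>d > 0\<close>] by blast
  then obtain p where p: "\<And>i. i \<le> d \<Longrightarrow> primeideal (p i) (mpoly_ring X)"
    "\<And>i. i \<le> d \<Longrightarrow> annihilator (mpoly_ring X) M \<subseteq> p i" "\<And>i. i < d \<Longrightarrow> p i \<subset> p (Suc i)"
    using R.primeideal_chain_Quot[OF annihilator_ideal] by metis
  have "\<exists>z. z \<in> p (Suc i) - p i" if "i < d" for i using p(3)[OF that] by blast
  then obtain y where y: "\<And>i. i < d \<Longrightarrow> y i \<in> p (Suc i) - p i" by metis
  have yX: "poly_in X (y i)" if "i < d" for i
    using y[OF that] primeideal_poly_in[OF p(1)[of "Suc i"]] that by auto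
  obtain g where g: "g \<in> G" "\<And>s. poly_in X s \<Longrightarrow> s \<odot>\<^bsub>M\<^esub> g = \<zero>\<^bsub>M\<^esub> \<Longrightarrow> s \<in> p 0"
    using primeideal_annihilator_gen[OF p(1)[of 0] p(2)[of 0]] by auto
  obtain D where D: "\<And>i. deg_le (D i) (y i)" using choice[of "\<lambda>i n. deg_le n (y i)"] deg_le_exists by blast
  \<comment> \<open>With exponents at most \<open>n\<close>, the product \<open>Y \<alpha>\<close>
    has degree at most \<open>n * E\<close>. The constant \<open>B\<close> absorbs the degrees of
    \<open>g\<close> and of the cone generators, which may be negative.\<close>
  define E where "E = (\<Sum>i<d. D i)"
  define B where "B = nat \<bar>hdeg gr g\<bar> + (\<Sum>x\<in>set P. nat \<bar>?dg (fst x)\<bar>)"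
  \<comment> \<open>Chosen so that the bound
    \<open>card (set P) * (Suc (E + B) * Suc n) ^ (d - 1)\<close> on the cone monomials equals
    \<open>n * Suc n ^ (d - 1)\<close>, which is less than \<open>Suc n ^ d\<close>.\<close>
  define n where "n = card (set P) * Suc (E + B) ^ (d - 1)"
  define N where "N = int (n * E) + hdeg gr g"
  define I where "I = ({0..<d} \<rightarrow>\<^sub>E {..n})"
  define Y where "Y \<alpha> = (\<Prod>i\<in>{0..<d}. y i ^ \<alpha> i)" for \<alpha>
  define v where "v \<alpha> = (\<lambda>h. Y \<alpha> * basis_vec g h)" for \<alpha>
  have YX: "poly_in X (Y \<alpha>)" for \<alpha>
    unfolding Y_def by (intro poly_in_prod poly_in_power yX) auto
  have vF: "v \<alpha> \<in> carrier (free_module X G)" for \<alpha>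
    unfolding v_def using free_module_mult[OF basis_vec_free_module[OF g(1)] YX] .
  have v_span: "v \<alpha> \<in> fv.span (cone_monomials ?dg P N \<union> pres_ker X M G)" if \<alpha>: "\<alpha> \<in> I" for \<alpha>
  proof (rule free_module_span[OF P vF])
    fix m assume "m \<in> mon_supp (v \<alpha>)"
    then have m: "snd m = g" "fst m \<in> Poly_Mapping.keys (Y \<alpha>)"
      by (auto simp: mon_supp_def v_def basis_vec_def split: if_splits)
    have "deg_le (\<Sum>i\<in>{0..<d}. \<alpha> i * D i) (Y \<alpha>)"
      unfolding Y_def using D by (intro deg_le_prod deg_le_power) auto
    moreover have "(\<Sum>i\<in>{0..<d}. \<alpha> i * D i) \<le> n * E"
      unfolding E_def sum_distrib_left atLeast0LessThan
      using \<alpha> by (intro sum_mono mult_right_mono) (auto simp: I_def)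
    ultimately have "monom_deg (fst m) \<le> n * E"
      using m(2) deg_le_mono unfolding deg_le_def by blast
    then show "mdeg gr m \<le> N" unfolding N_def m(1) by linarith
  qed
  have K: "N - ?dg h \<le> int (n * E + B)" if "(h, U) \<in> set P" for h U
  proof -
    have "nat \<bar>?dg (fst (h, U))\<bar> \<le> (\<Sum>x\<in>set P. nat \<bar>?dg (fst x)\<bar>)"
      using that by (intro member_le_sum) auto
    then show ?thesis unfolding N_def B_def fst_conv by linarith
  qed
  have cones: "finite U \<and> card U \<le> d - 1 \<and> N - ?dg h \<le> int (n * E + B)" if "(h, U) \<in> set P" for h U
    using that contr K[OF that] finite_subset[OF cone_generator(2)[OF P that] finite_vars] by fastforce
  have "card (cone_monomials ?dg P N) \<le> card (set P) * Suc (n * E + B) ^ (d - 1)"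
    by (rule cone_monomials_card(2)) (rule cones)
  also have "\<dots> \<le> card (set P) * (Suc (E + B) * Suc n) ^ (d - 1)"
    by (intro mult_left_mono power_mono) (auto simp: algebra_simps)
  also have "\<dots> = n * Suc n ^ (d - 1)" by (simp only: n_def power_mult_distrib mult.assoc)
  also have "\<dots> < Suc n * Suc n ^ (d - 1)" by simp
  also have "\<dots> = Suc n ^ d" using \<open>d > 0\<close> by (metis Suc_diff_1 power_Suc)
  also have "\<dots> = card I" by (simp add: I_def card_PiE)
  finally have less: "card (cone_monomials ?dg P N) < card I" .
  have fin: "finite (cone_monomials ?dg P N)"
    by (rule cone_monomials_card(1)) (rule cones)
  have "finite I" by (simp add: I_def finite_PiE)
  obtain c where c: "\<exists>\<alpha>\<in>I. c \<alpha> \<noteq> 0" "(\<Sum>\<alpha>\<in>I. fscale (c \<alpha>) (v \<alpha>)) \<in> pres_ker X M G"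
    using fv.dependent_modulo_subspace[OF pres_ker_subspace fin \<open>finite I\<close> less, of v] v_span
    by blast
  \<comment> \<open>The relation among the \<open>v \<alpha>\<close> is \<open>s\<close> times the
    basis element of \<open>g\<close>, so \<open>s\<close> kills \<open>g\<close> and must lie in
    \<open>p 0\<close>.\<close>
  define s where "s = (\<Sum>\<alpha>\<in>I. Poly_Mapping.single 0 (c \<alpha>) * Y \<alpha>)"
  have sX: "poly_in X s" unfolding s_def by (intro poly_in_sum poly_in_mult YX) auto
  have "(\<Sum>\<alpha>\<in>I. fscale (c \<alpha>) (v \<alpha>)) = (\<lambda>h. s * basis_vec g h)"
    by (simp add: fun_eq_iff sum_fun_apply fscale_def v_def s_def sum_distrib_right mult.assoc)
  then have "s \<odot>\<^bsub>M\<^esub> g = \<zero>\<^bsub>M\<^esub>"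
    using c(2) ev_mult[OF basis_vec_free_module[OF g(1)] sX] ev_basis_vec[OF g(1)] by (simp add: pres_ker_iff)
  then have "s \<in> p 0" using g(2) sX by blast
  \<comment> \<open>Vanishing coefficients are dropped, as the independence lemma takes a nonempty
    set of nonzero ones.\<close>
  moreover have "s = (\<Sum>\<alpha>\<in>{\<alpha> \<in> I. c \<alpha> \<noteq> 0}. Poly_Mapping.single 0 (c \<alpha>) * Y \<alpha>)"
    unfolding s_def using \<open>finite I\<close> by (intro sum.mono_neutral_right) auto
  moreover have "(\<Sum>\<alpha>\<in>{\<alpha> \<in> I. c \<alpha> \<noteq> 0}. Poly_Mapping.single 0 (c \<alpha>) * Y \<alpha>) \<notin> p 0"
    unfolding Y_def
  proof (rule primeideal_chain_independent[where d = d])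
    \<comment> \<open>Members of \<open>I\<close> are extensional on \<open>{0..<d}\<close>, so
      restriction leaves them unchanged.\<close>
    show "inj_on (\<lambda>\<alpha>. restrict \<alpha> {0..<d}) {\<alpha> \<in> I. c \<alpha> \<noteq> 0}"
      by (rule inj_onI) (auto simp: I_def PiE_restrict)
    show "p i \<subseteq> p (Suc i)" if "i < d" for i using p(3)[OF that] by blast
  qed (use p y c(1) \<open>finite I\<close> in auto)
  ultimately show False by simp
qed

text \<open>A kernel element with leading monomial \<open>e\<^sub>g\<close> may be taken homogeneous; its \<open>g\<close>-coordinate is
  then a nonzero constant, so \<open>g\<close> would be redundant.\<close>

lemma basis_monomial_standard:
  assumes min: "min_hom_gens (mpoly_ring X) M gr G" and g: "g \<in> G"
  shows "(mon_vec (0, g) :: 'm \<Rightarrow> ('x, 'k) mpoly) \<notin> initial_module X G ord (pres_ker X M G)"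
proof
  assume "(mon_vec (0, g) :: 'm \<Rightarrow> ('x, 'k) mpoly) \<in> initial_module X G ord (pres_ker X M G)"
  then obtain f where f: "f \<in> pres_ker X M G" "f \<in> free_comp X G gr (hdeg gr g)" "(0, g) \<in> mon_supp f"
    by (rule initial_module_monomial_homogeneous) auto
  define c where "c = Poly_Mapping.lookup (f g) 0"
  have c0: "c \<noteq> 0" using f(3) by (simp add: c_def mon_supp_def in_keys_iff)
  have fg: "f g = Poly_Mapping.single 0 c"
  proof (rule poly_mapping_eqI)
    fix u show "Poly_Mapping.lookup (f g) u = Poly_Mapping.lookup (Poly_Mapping.single 0 c) u"
    proof (cases "u = 0")
      case False
      then have "u \<notin> Poly_Mapping.keys (f g)" using f(2) g by (auto simp: free_comp_def)
      then show ?thesis using False by (simp add: in_keys_iff lookup_single when_def)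
    qed (simp add: c_def)
  qed
  \<comment> \<open>Adding this kernel element to the basis element of \<open>g\<close> cancels the
    coordinate at \<open>g\<close> without changing the image \<open>g\<close>.\<close>
  let ?t = "fscale (- inverse c) f"
  have t: "?t \<in> carrier (free_module X G)" "ev ?t = \<zero>\<^bsub>M\<^esub>"
    using fv.subspace_scale[OF pres_ker_subspace f(1), of "- inverse c"] by (auto simp: pres_ker_iff)
  have h: "basis_vec g + ?t \<in> carrier (free_module X G)"
    by (rule free_module_add[OF basis_vec_free_module[OF g] t(1)])
  have "(basis_vec g + ?t) g = 0"
    using c0 by (simp add: basis_vec_def fscale_def fg mult_single single_uminus)
  moreover have "ev (basis_vec g + ?t) = g"
    using ev_add[OF basis_vec_free_module[OF g] t(1)] t(2) ev_basis_vec[OF g] gens_carrier[OF g] by simp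
  ultimately show False
    using min_hom_gens_redundant[OF min g] ev_in_submodule[OF _ h] by (metis DiffI singletonD subsetD)
qed

text \<open>The basis monomial of \<open>g\<close> is standard, so some summand \<open>p * h\<close>
  contains it. The exponent 0 arises only as 0 + 0, so \<open>h\<close> itself contains this
  monomial and, being homogeneous, has its degree.\<close>

lemma cone_generator_of_degree:
  assumes min: "min_hom_gens (mpoly_ring X) M gr G"
    and P: "cone_decomposition X M gr G ord P" and g: "g \<in> G"
  shows "\<exists>(h, U)\<in>set P. hdeg (free_comp X G gr) h = hdeg gr g"
proof -
  let ?e = "mon_vec (0, g) :: 'm \<Rightarrow> ('x, 'k) mpoly"
  have "?e \<in> standard_space X G ord (pres_ker X M G)"
    using basis_monomial_standard[OF min g] mon_vec_free_module[of "(0, g)" X G] g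
    by (simp add: standard_space_def)
  then obtain c where c: "\<And>i. i < length P \<Longrightarrow> c i \<in> cone (fst (P ! i)) (snd (P ! i))"
    "?e = (\<lambda>g. \<Sum>i<length P. c i g)"
    using cone_decomposition_sum[OF P] by blast
  have "(\<Sum>i<length P. Poly_Mapping.lookup (c i g) 0) = 1"
    using fun_cong[OF c(2), of g] by (simp add: mon_vec_def flip: lookup_sum)
  then have "(\<Sum>i<length P. Poly_Mapping.lookup (c i g) 0) \<noteq> 0" by simp
  then obtain i where i: "i < length P" "Poly_Mapping.lookup (c i g) 0 \<noteq> 0"
    by (rule sum.not_neutral_contains_not_neutral) auto
  obtain h U where hU: "P ! i = (h, U)" by (cases "P ! i")
  then have hP: "(h, U) \<in> set P" using i(1) nth_mem by metis
  obtain p where p: "c i = (\<lambda>g. p * h g)" using c(1)[OF i(1)] by (auto simp: hU cone_def)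
  have "0 \<in> Poly_Mapping.keys (p * h g)" using i(2) by (simp add: p in_keys_iff)
  then obtain a b where "0 = a + b" "b \<in> Poly_Mapping.keys (h g)"
    using keys_mult[of p "h g"] by blast
  moreover from this have "b = 0"
    by (metis add_is_0 monom_deg_0 monom_deg_add monom_deg_eq_0)
  ultimately have "(0, g) \<in> mon_supp h" by (simp add: mon_supp_def)
  then have "hdeg (free_comp X G gr) h = hdeg gr g"
    using cone_generator(1)[OF P hP] unfolding free_comp_iff by force
  then show ?thesis using hP by blast
qed

end

section \<open>The inequalities between the constants\<close>

text \<open>A nonempty range at \<open>j\<close> yields a cone generator of degree
  \<open>b j - 1\<close>, hence \<open>b j \<le> b 0\<close>; an empty range means
  \<open>b j = b (Suc j)\<close>. Descending from \<open>d\<close>, where the range is nonempty,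
  reaches \<open>b 1\<close>.\<close>

lemma cone_form_bound:
  assumes form: "cone_form dg e d P b" and "d > 0" and top: "b (Suc d) < b d"
  shows "b 1 \<le> b 0"
proof -
  have cone_deg: "b j \<le> b 0" if j: "j \<in> {1..d}" "b (Suc j) < b j" for j
  proof -
    have "bij_betw (\<lambda>i. dg (fst (P ! i))) {i. i < length P \<and> card (snd (P ! i)) = j} {b (Suc j)..b j - 1}"
      using form j(1) unfolding cone_form_def by blast
    then have "b j - 1 \<in> (\<lambda>i. dg (fst (P ! i))) ` {i. i < length P \<and> card (snd (P ! i)) = j}"
      using j(2) by (simp add: bij_betw_def)
    then obtain i where i: "i < length P" "dg (fst (P ! i)) = b j - 1" by auto
    then have "b j - 1 \<in> (\<lambda>(h, U). dg h) ` set P"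
      using nth_mem[OF i(1)] by (intro image_eqI[of _ _ "P ! i"]) (simp_all add: case_prod_beta)
    then have "b j - 1 \<le> Max ((\<lambda>(h, U). dg h) ` set P)" by (intro Max_ge) auto
    then show ?thesis using form by (simp add: cone_form_def)
  qed
  have "b j \<le> b 0" if "1 \<le> j" "j \<le> d" for j
    using that(2,1)
  proof (induction rule: inc_induct)
    case base
    then show ?case using cone_deg[of d] top by simp
  next
    case (step j)
    have "b (Suc j) \<le> b j" using form step by (simp add: cone_form_def)
    then show ?case using cone_deg[of j] step by force
  qed
  then show ?thesis using \<open>d > 0\<close> by simp
qed

theorem proposition3p10:
  fixes X :: "'x set"
    and M :: "(('x, 'k::field) mpoly, 'm) module"
    and gr :: "int \<Rightarrow> 'm set"
    and d :: nat
    and b :: "nat \<Rightarrow> int"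
  assumes "graded_module X M gr"
    and "finitely_generated (mpoly_ring X) M"
    and "carrier M \<noteq> {\<zero>\<^bsub>M\<^esub>}"
    and "module_dim (mpoly_ring X) M = enat d"
    and "macaulay_constants X M gr d b"
  shows "(\<forall>i<d. b (Suc i) \<le> b i) \<and> b (Suc d) < b d \<and> b (Suc d) = e_plus (mpoly_ring X) M gr"
proof -
  let ?e = "e_plus (mpoly_ring X) M gr"
  interpret graded_module X M gr by fact
  obtain G ord P where min: "min_hom_gens (mpoly_ring X) M gr G" and ord: "monomial_order X G ord"
    and P: "cone_decomposition X M gr G ord P"
    and form: "cone_form (hdeg (free_comp X G gr)) ?e d P b"
    using assms(5) unfolding macaulay_constants_def by blast
  interpret hom_gens X M gr G by (rule min_hom_gens_hom_gens[OF min])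
  interpret ordered_hom_gens X M gr G ord by unfold_locales (rule ord)
  have e: "b (Suc d) = ?e" using form by (simp add: cone_form_def)
  have mono: "b (Suc i) \<le> b i" if "0 < i" "i \<le> d" for i
    using form that by (simp add: cone_form_def)
  have top: "b (Suc d) < b d"
  proof (cases "d = 0")
    case True
    \<comment> \<open>For \<open>d = 0\<close> the claim compares e with one plus the largest degree
      of a cone generator, so one generator of degree e suffices.\<close>
    have "?e \<in> hdeg gr ` G"
      unfolding e_plus_eq[OF min] using finite_gens gens_nonempty[OF assms(3)] by (intro Max_in) auto
    then obtain g where "g \<in> G" "?e = hdeg gr g" by blast
    then have "?e \<in> (\<lambda>(h, U). hdeg (free_comp X G gr) h) ` set P"
      using cone_generator_of_degree[OF min P] by force
    then have "?e \<le> Max ((\<lambda>(h, U). hdeg (free_comp X G gr) h) ` set P)" by (intro Max_ge) auto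
    then show ?thesis using form True by (simp add: cone_form_def)
  next
    case False
    then obtain h U where hU: "(h, U) \<in> set P" "d \<le> card U"
      using cone_of_large_dimension[OF P assms(4)] by blast
    then obtain i where "i < length P" "P ! i = (h, U)" by (metis in_set_conv_nth)
    \<comment> \<open>No cone exceeds dimension \<open>d\<close>, so this one has dimension exactly
      \<open>d\<close>, and its degree makes the range for \<open>j = d\<close> nonempty.\<close>
    moreover have "card U = d" using hU form by (force simp: cone_form_def)
    ultimately have "i \<in> {i. i < length P \<and> card (snd (P ! i)) = d}" by simp
    moreover have "bij_betw (\<lambda>i. hdeg (free_comp X G gr) (fst (P ! i)))
        {i. i < length P \<and> card (snd (P ! i)) = d} {b (Suc d)..b d - 1}"
    proof -
      have "d \<in> {1..d}" using False by simp
      then show ?thesis using form unfolding cone_form_def by blast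
    qed
    ultimately have "hdeg (free_comp X G gr) (fst (P ! i)) \<in> {b (Suc d)..b d - 1}"
      using bij_betw_apply by fast
    then show ?thesis by simp
  qed
  \<comment> \<open>\<open>cone_form\<close> supplies the inequalities from index 1 on; the
    comparison of \<open>b 1\<close> with \<open>b 0\<close> rests on
    \<open>cone_form_bound\<close>.\<close>
  have "b (Suc i) \<le> b i" if "i < d" for i
  proof (cases "i = 0")
    case True
    then show ?thesis using cone_form_bound[OF form _ top] that by simp
  next
    case False
    then show ?thesis using mono that by simp
  qed
  then show ?thesis using top e by blast
qed

end
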